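(* For every frequency $\lambda=(\lambda_n)$ the following statements are equivalent: (i) Bohr's theorem holds for $\lambda$. (ii) $\mathcal{D}_{\infty,+}(\lambda)$ is a Montel space.
   Context: A frequency is a strictly increasing unbounded sequence $\lambda=(\lambda_n)_{n\ge 1}$ of non-negative real numbers. A $\lambda$-Dirichlet series is a formal series $D=\sum a_n e^{-\lambda_n s}$ with $a_n\in\mathbb{C}$ and $s$ a complex variable. Write $[\mathrm{Re}>\sigma]=\{s\in\mathbb{C}:\mathrm{Re}\,s>\sigma\}$. If $D$ converges at some point then it converges on some half-plane, where its limit function is holomorphic. Let $\sigma_u(D)=\inf\{\sigma\in\mathbb{R}: D \text{ converges uniformly on } [\mathrm{Re}>\sigma]\}$. Bohr's theorem holds for $\lambda$ if $\sigma_u(D)\le 0$ for every $D\in\mathcal{D}_\infty^{\mathrm{ext}}(\lambda)$, where $\mathcal{D}_\infty^{\mathrm{ext}}(\lambda)$ is the space of all $\lambda$-Dirichlet series that converge somewhere and whose limit function extends to a bounded holomorphic function on $[\mathrm{Re}>0]$. $\mathcal{D}_{\infty,+}(\lambda)$ is the space of all $\lambda$-Dirichlet series that converge on $[\mathrm{Re}>0]$ to a (necessarily holomorphic) function which is bounded on $[\mathrm{Re}>\sigma]$ for each $\sigma>0$, with the locally convex topology given by the norms $\|D\|_{k}=\sup_{\mathrm{Re}\,s>1/k}|D(s)|$, $k\in\mathbb{N}$. A locally convex space is barrelled if every barrel (absolutely convex, closed, absorbing set) is a zero-neighbourhood; it is semi-Montel if every bounded set is relatively compact; it is Montel if it is both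 barrelled and semi-Montel. *)

theory Defs
  imports "HOL-Analysis.Analysis" "HOL-Library.Function_Algebras"
begin

section \<open>General Dirichlet series\<close>

text \<open>
  Sequences are indexed from 0, so \<open>\<lambda>\<^sub>n\<close> and \<open>a\<^sub>n\<close> for \<open>n \<ge> 1\<close> are \<open>lam (n - 1)\<close> and
  \<open>a (n - 1)\<close>. A formal Dirichlet series over a fixed frequency is its sequence of coefficients.
\<close>

definition frequency :: "(nat \<Rightarrow> real) \<Rightarrow> bool" where
  "frequency lam \<longleftrightarrow> strict_mono lam \<and> (\<forall>n. 0 \<le> lam n) \<and> \<not> bdd_above (range lam)"

abbreviation right_half_plane :: "real \<Rightarrow> complex set" where
  "right_half_plane \<sigma> \<equiv> {s. \<sigma> < Re s}"

definition dirichlet_term :: "(nat \<Rightarrow> real) \<Rightarrow> (nat \<Rightarrow> complex) \<Rightarrow> complex \<Rightarrow> nat \<Rightarrow> complex" where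
  "dirichlet_term lam a s n = a n * exp (- (of_real (lam n) * s))"

definition dirichlet_converges :: "(nat \<Rightarrow> real) \<Rightarrow> (nat \<Rightarrow> complex) \<Rightarrow> complex \<Rightarrow> bool" where
  "dirichlet_converges lam a s \<longleftrightarrow> summable (dirichlet_term lam a s)"

definition dirichlet_limit :: "(nat \<Rightarrow> real) \<Rightarrow> (nat \<Rightarrow> complex) \<Rightarrow> complex \<Rightarrow> complex" where
  "dirichlet_limit lam a s = (\<Sum>n. dirichlet_term lam a s n)"

definition sigma_c :: "(nat \<Rightarrow> real) \<Rightarrow> (nat \<Rightarrow> complex) \<Rightarrow> ereal" where
  "sigma_c lam a =
     Inf (ereal ` {\<sigma>. \<forall>s\<in>right_half_plane \<sigma>. dirichlet_converges lam a s})"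

definition sigma_u :: "(nat \<Rightarrow> real) \<Rightarrow> (nat \<Rightarrow> complex) \<Rightarrow> ereal" where
  "sigma_u lam a =
     Inf (ereal ` {\<sigma>. uniformly_convergent_on (right_half_plane \<sigma>)
                        (\<lambda>N s. \<Sum>n<N. dirichlet_term lam a s n)})"

text \<open>
  The limit function lives on the open half-plane of convergence, so an extension to
  \<open>[Re > 0]\<close> has to agree with it wherever both are defined.
\<close>

definition D_infty_ext :: "(nat \<Rightarrow> real) \<Rightarrow> (nat \<Rightarrow> complex) set" where
  "D_infty_ext lam =
     {a. (\<exists>s. dirichlet_converges lam a s) \<and>
         (\<exists>f. f holomorphic_on right_half_plane 0 \<and> bounded (f ` right_half_plane 0) \<and>
              (\<forall>s\<in>right_half_plane 0. sigma_c lam a < ereal (Re s) \<longrightarrow>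
                 f s = dirichlet_limit lam a s))}"

definition bohr_theorem_holds :: "(nat \<Rightarrow> real) \<Rightarrow> bool" where
  "bohr_theorem_holds lam \<longleftrightarrow> (\<forall>a\<in>D_infty_ext lam. sigma_u lam a \<le> 0)"


section \<open>Locally convex spaces\<close>

text \<open>
  A locally convex space is given by a complex scalar multiplication \<open>smul\<close> on an additive group
  and a topology whose underlying set is a linear subspace of that group.
\<close>

definition seminorm_topology ::
    "'v::ab_group_add set \<Rightarrow> 'i set \<Rightarrow> ('i \<Rightarrow> 'v \<Rightarrow> real) \<Rightarrow> 'v topology" where
  "seminorm_topology V I p =
     topology_generated_by {{y \<in> V. p i (y - x) < e} |i x e. i \<in> I \<and> x \<in> V \<and> 0 < e}"

definition zero_neighbourhood :: "'v::ab_group_add topology \<Rightarrow> 'v set \<Rightarrow> bool" where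
  "zero_neighbourhood T U \<longleftrightarrow> U \<subseteq> topspace T \<and> (\<exists>W. openin T W \<and> 0 \<in> W \<and> W \<subseteq> U)"

definition absolutely_convex ::
    "(complex \<Rightarrow> 'v \<Rightarrow> 'v) \<Rightarrow> 'v::ab_group_add set \<Rightarrow> bool" where
  "absolutely_convex smul A \<longleftrightarrow>
     (\<forall>x\<in>A. \<forall>y\<in>A. \<forall>c d. norm c + norm d \<le> 1 \<longrightarrow> smul c x + smul d y \<in> A)"

definition absorbs :: "(complex \<Rightarrow> 'v \<Rightarrow> 'v) \<Rightarrow> 'v set \<Rightarrow> 'v set \<Rightarrow> bool" where
  "absorbs smul A B \<longleftrightarrow> (\<exists>r>0. \<forall>c. r \<le> norm c \<longrightarrow> B \<subseteq> smul c ` A)"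

definition absorbing :: "(complex \<Rightarrow> 'v \<Rightarrow> 'v) \<Rightarrow> 'v topology \<Rightarrow> 'v set \<Rightarrow> bool" where
  "absorbing smul T A \<longleftrightarrow> (\<forall>x\<in>topspace T. absorbs smul A {x})"

definition barrel :: "(complex \<Rightarrow> 'v \<Rightarrow> 'v) \<Rightarrow> 'v::ab_group_add topology \<Rightarrow> 'v set \<Rightarrow> bool" where
  "barrel smul T A \<longleftrightarrow> absolutely_convex smul A \<and> closedin T A \<and> absorbing smul T A"

definition barrelled_space ::
    "(complex \<Rightarrow> 'v \<Rightarrow> 'v) \<Rightarrow> 'v::ab_group_add topology \<Rightarrow> bool" where
  "barrelled_space smul T \<longleftrightarrow> (\<forall>A. barrel smul T A \<longrightarrow> zero_neighbourhood T A)"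

definition bounded_in_lcs ::
    "(complex \<Rightarrow> 'v \<Rightarrow> 'v) \<Rightarrow> 'v::ab_group_add topology \<Rightarrow> 'v set \<Rightarrow> bool" where
  "bounded_in_lcs smul T B \<longleftrightarrow>
     B \<subseteq> topspace T \<and> (\<forall>U. zero_neighbourhood T U \<longrightarrow> absorbs smul U B)"

definition semi_montel_space ::
    "(complex \<Rightarrow> 'v \<Rightarrow> 'v) \<Rightarrow> 'v::ab_group_add topology \<Rightarrow> bool" where
  "semi_montel_space smul T \<longleftrightarrow>
     (\<forall>B. bounded_in_lcs smul T B \<longrightarrow> compactin T (T closure_of B))"

definition montel_space ::
    "(complex \<Rightarrow> 'v \<Rightarrow> 'v) \<Rightarrow> 'v::ab_group_add topology \<Rightarrow> bool" where
  "montel_space smul T \<longleftrightarrow> barrelled_space smul T \<and> semi_montel_space smul T"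


section \<open>The space of Dirichlet series bounded on all smaller half-planes\<close>

definition coeff_scale :: "complex \<Rightarrow> (nat \<Rightarrow> complex) \<Rightarrow> (nat \<Rightarrow> complex)" where
  "coeff_scale c a = (\<lambda>n. c * a n)"

definition D_infty_plus :: "(nat \<Rightarrow> real) \<Rightarrow> (nat \<Rightarrow> complex) set" where
  "D_infty_plus lam =
     {a. (\<forall>s\<in>right_half_plane 0. dirichlet_converges lam a s) \<and>
         (\<forall>\<sigma>>0. bounded (dirichlet_limit lam a ` right_half_plane \<sigma>))}"

definition D_infty_plus_norm :: "(nat \<Rightarrow> real) \<Rightarrow> nat \<Rightarrow> (nat \<Rightarrow> complex) \<Rightarrow> real" where
  "D_infty_plus_norm lam k a =
     (SUP s\<in>right_half_plane (1 / real k). norm (dirichlet_limit lam a s))"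

text \<open>The index \<open>k = 0\<close> is excluded: the supremum over \<open>[Re > 0]\<close> need not be finite.\<close>

definition D_infty_plus_topology :: "(nat \<Rightarrow> real) \<Rightarrow> (nat \<Rightarrow> complex) topology" where
  "D_infty_plus_topology lam =
     seminorm_topology (D_infty_plus lam) {1..} (D_infty_plus_norm lam)"


subsection \<open>Well-definedness of the locally convex structure\<close>

lemma vector_space_coeff_scale: "vector_space coeff_scale"
  by unfold_locales (auto simp: coeff_scale_def algebra_simps)

lemma dirichlet_term_add:
  "dirichlet_term lam (a + b) s = (\<lambda>n. dirichlet_term lam a s n + dirichlet_term lam b s n)"
  by (auto simp: dirichlet_term_def algebra_simps)

lemma dirichlet_term_scale:
  "dirichlet_term lam (coeff_scale c a) s = (\<lambda>n. c * dirichlet_term lam a s n)"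
  by (auto simp: dirichlet_term_def coeff_scale_def algebra_simps)

lemma dirichlet_limit_add:
  assumes "a \<in> D_infty_plus lam" "b \<in> D_infty_plus lam" "0 < Re s"
  shows "dirichlet_limit lam (a + b) s = dirichlet_limit lam a s + dirichlet_limit lam b s"
  using assms
  by (auto simp: dirichlet_limit_def dirichlet_term_add D_infty_plus_def dirichlet_converges_def
           intro!: suminf_add[symmetric])

lemma dirichlet_limit_scale:
  assumes "a \<in> D_infty_plus lam" "0 < Re s"
  shows "dirichlet_limit lam (coeff_scale c a) s = c * dirichlet_limit lam a s"
  using assms
  by (auto simp: dirichlet_limit_def dirichlet_term_scale D_infty_plus_def dirichlet_converges_def
           intro!: suminf_mult)

lemma D_infty_plus_subspace: "module.subspace coeff_scale (D_infty_plus lam)"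
proof -
  interpret vector_space coeff_scale by (rule vector_space_coeff_scale)
  show ?thesis
  proof (rule subspaceI)
    have "dirichlet_term lam 0 s = (\<lambda>n. 0)" for s
      by (auto simp: dirichlet_term_def)
    then show "0 \<in> D_infty_plus lam"
      by (auto simp: D_infty_plus_def dirichlet_converges_def dirichlet_limit_def bounded_iff)
  next
    fix a b assume ab: "a \<in> D_infty_plus lam" "b \<in> D_infty_plus lam"
    have "bounded (dirichlet_limit lam (a + b) ` right_half_plane \<sigma>)" if \<sigma>: "\<sigma> > 0" for \<sigma>
    proof -
      have "dirichlet_limit lam (a + b) ` right_half_plane \<sigma> =
            (\<lambda>s. dirichlet_limit lam a s + dirichlet_limit lam b s) ` right_half_plane \<sigma>"
        using \<sigma> by (intro image_cong) (auto intro!: dirichlet_limit_add ab)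
      then show ?thesis
        using ab \<sigma> by (auto simp: D_infty_plus_def intro!: bounded_plus_comp)
    qed
    then show "a + b \<in> D_infty_plus lam"
      using ab by (auto simp: D_infty_plus_def dirichlet_converges_def dirichlet_term_add
                        intro!: summable_add)
  next
    fix c a assume a: "a \<in> D_infty_plus lam"
    have "bounded (dirichlet_limit lam (coeff_scale c a) ` right_half_plane \<sigma>)"
      if \<sigma>: "\<sigma> > 0" for \<sigma>
    proof -
      have eq: "dirichlet_limit lam (coeff_scale c a) ` right_half_plane \<sigma> =
            (\<lambda>z. c * z) ` dirichlet_limit lam a ` right_half_plane \<sigma>"
        unfolding image_image
        using \<sigma> by (intro image_cong) (auto intro!: dirichlet_limit_scale a)
      have "bounded (dirichlet_limit lam a ` right_half_plane \<sigma>)"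
        using a \<sigma> by (auto simp: D_infty_plus_def)
      then show ?thesis
        unfolding eq by (rule bounded_linear_image[OF _ bounded_linear_mult_right])
    qed
    then show "coeff_scale c a \<in> D_infty_plus lam"
      using a by (auto simp: D_infty_plus_def dirichlet_converges_def dirichlet_term_scale
                       intro!: summable_mult)
  qed
qed

lemma D_infty_plus_norm_bdd:
  assumes "a \<in> D_infty_plus lam" "1 \<le> k"
  shows "bdd_above ((\<lambda>s. norm (dirichlet_limit lam a s)) ` right_half_plane (1 / real k))"
proof -
  have "bounded (dirichlet_limit lam a ` right_half_plane (1 / real k))"
    using assms by (auto simp: D_infty_plus_def)
  then show ?thesis
    by (auto simp: bounded_iff bdd_above_def)
qed

lemma right_half_plane_nonempty: "right_half_plane \<sigma> \<noteq> {}"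
proof -
  have "complex_of_real (\<sigma> + 1) \<in> right_half_plane \<sigma>" by simp
  then show ?thesis by blast
qed

lemma D_infty_plus_norm_triangle:
  assumes "a \<in> D_infty_plus lam" "b \<in> D_infty_plus lam" "1 \<le> k"
  shows "D_infty_plus_norm lam k (a + b) \<le> D_infty_plus_norm lam k a + D_infty_plus_norm lam k b"
  unfolding D_infty_plus_norm_def
proof (rule cSUP_least[OF right_half_plane_nonempty])
  fix s assume s: "s \<in> right_half_plane (1 / real k)"
  have "0 < 1 / real k" using assms(3) by simp
  with s have "0 < Re s" by (simp del: zero_less_divide_1_iff)
  then have "norm (dirichlet_limit lam (a + b) s)
      \<le> norm (dirichlet_limit lam a s) + norm (dirichlet_limit lam b s)"
    by (simp add: dirichlet_limit_add assms norm_triangle_ineq)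
  also have "\<dots> \<le> (SUP s\<in>right_half_plane (1 / real k). norm (dirichlet_limit lam a s))
      + (SUP s\<in>right_half_plane (1 / real k). norm (dirichlet_limit lam b s))"
    by (intro add_mono cSUP_upper s D_infty_plus_norm_bdd assms)
  finally show "norm (dirichlet_limit lam (a + b) s) \<le> \<dots>" .
qed

lemma D_infty_plus_norm_scale:
  assumes "a \<in> D_infty_plus lam" "1 \<le> k"
  shows "D_infty_plus_norm lam k (coeff_scale c a) = norm c * D_infty_plus_norm lam k a"
proof -
  have k: "0 < 1 / real k" using assms(2) by simp
  have "D_infty_plus_norm lam k (coeff_scale c a)
      = (SUP s\<in>right_half_plane (1 / real k). norm c * norm (dirichlet_limit lam a s))"
    unfolding D_infty_plus_norm_def
  proof (rule SUP_cong[OF refl])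
    fix s assume "s \<in> right_half_plane (1 / real k)"
    with k have "0 < Re s" by (simp del: zero_less_divide_1_iff)
    then show "norm (dirichlet_limit lam (coeff_scale c a) s)
        = norm c * norm (dirichlet_limit lam a s)"
      by (simp add: dirichlet_limit_scale assms norm_mult)
  qed
  also have "\<dots> = norm c * D_infty_plus_norm lam k a"
  proof -
    have "continuous (at_left x) ((*) (norm c))" for x :: real
      by (intro continuous_intros)
    then show ?thesis
      unfolding D_infty_plus_norm_def
      using continuous_at_Sup_mono[of "(*) (norm c)"
              "(\<lambda>s. norm (dirichlet_limit lam a s)) ` right_half_plane (1 / real k)"]
        D_infty_plus_norm_bdd[OF assms] right_half_plane_nonempty[of "1 / real k"]
      by (simp add: image_image mono_def mult_left_mono)
  qed
  finally show ?thesis .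
qed

lemma topspace_D_infty_plus: "topspace (D_infty_plus_topology lam) = D_infty_plus lam"
proof
  show "topspace (D_infty_plus_topology lam) \<subseteq> D_infty_plus lam"
    unfolding D_infty_plus_topology_def seminorm_topology_def topology_generated_by_topspace
    by auto
next
  show "D_infty_plus lam \<subseteq> topspace (D_infty_plus_topology lam)"
  proof
    fix a assume a: "a \<in> D_infty_plus lam"
    define e where "e = \<bar>D_infty_plus_norm lam 1 (a - a)\<bar> + 1"
    have "0 < e" "D_infty_plus_norm lam 1 (a - a) < e"
      unfolding e_def by linarith+
    moreover have "(1::nat) \<in> {1..}" by simp
    ultimately show "a \<in> topspace (D_infty_plus_topology lam)"
      unfolding D_infty_plus_topology_def seminorm_topology_def topology_generated_by_topspace
      using a by (intro UnionI[of "{y \<in> D_infty_plus lam. D_infty_plus_norm lam 1 (y - a) < e}"]) blast+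
  qed
qed

end

theory Submission
  imports Defs "HOL-Complex_Analysis.Conformal_Mappings" "HOL-Probability.Characteristic_Functions"
begin

text \<open>
  Both implications come down to bounding the partial sums of a Dirichlet series on a half-plane by
  the supremum of its limit function on a slightly larger one.

  \<^bold>\<open>Montel implies Bohr, through barrelledness.\<close> Since a series in the space converges at the real
  point \<open>\<sigma> > 0\<close>, the set of all series whose partial sums at \<open>\<sigma>\<close> stay in the
  unit disc is a barrel, so the partial sums at \<open>\<sigma>\<close> are bounded by a multiple of one of the norms
  (\<open>barrelled_partial_sum_bound\<close>). The norms do not increase when \<open>s\<close> is replaced by
  \<open>s + w\<close> with \<open>Re w \<ge> 0\<close>, so the bound holds on all of \<open>[Re \<ge>
  \<sigma>]\<close>. Now let \<open>f\<close> be a bounded holomorphic extension of a series with coefficients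
  \<open>a\<^sub>n\<close> that is only known to converge somewhere. The Gaussian mean of \<open>f\<close> along
  vertical lines with deviation \<open>R\<close> is the limit function of the series with coefficients
  \<open>a\<^sub>n exp (- R\<^sup>2 \<lambda>\<^sub>n\<^sup>2 / 2)\<close>. That series converges everywhere and is
  bounded by \<open>sup |f|\<close>, so it lies in the space, and its partial sums obey the bound with a constant
  independent of \<open>R\<close>. Letting \<open>R \<rightarrow> 0\<close> bounds the partial sums of the original
  series on \<open>[Re \<ge> \<sigma>]\<close>, and Abel summation turns this into uniform convergence on every
  smaller half-plane.

  Gaussian means with \<open>R \<rightarrow> \<infinity>\<close>, taken after multiplication by \<open>exp
  (\<lambda>\<^sub>m s)\<close>, isolate the coefficient \<open>a\<^sub>m\<close>. This bounds the coefficients by the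
  norms (\<open>coefficient_bound\<close>) and makes the barrel above closed.

  \<^bold>\<open>Bohr implies Montel.\<close> A gliding hump argument makes the Bohr theorem quantitative: if no
  constant \<open>C\<close> bounded the partial sums at \<open>\<sigma>\<close> of all Dirichlet polynomials by
  \<open>C\<close> times their supremum on \<open>[Re > 0]\<close>, one could add up polynomials with disjoint blocks
  of frequencies, of suprema \<open>2\<^sup>-\<^sup>j\<close> and with largest modulus of a partial sum at
  \<open>\<sigma>\<close> equal to 1. The resulting series converges to the right of \<open>\<sigma>\<close> and has a
  bounded extension, but diverges at \<open>\<sigma>\<close>, contrary to the Bohr theorem
  (\<open>bohr_polynomial_bound\<close>). The bound carries over to the whole space
  (\<open>bohr_partial_sum_bound\<close>). Therefore, on a set that is bounded in all norms, the partial sums are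
  bounded uniformly, the tails are uniformly small, and the topology of the space is that of convergence of each
  coefficient. By Tychonoff's theorem such sets are compact, which is the semi-Montel property, and the same
  compactness replaces completeness in a Baire category argument for barrelledness.
\<close>

section \<open>Abel summation and half-planes of convergence\<close>

abbreviation partial_sum :: "(nat \<Rightarrow> real) \<Rightarrow> (nat \<Rightarrow> complex) \<Rightarrow> complex \<Rightarrow> nat \<Rightarrow> complex" where
  "partial_sum lam a s N \<equiv> (\<Sum>n<N. dirichlet_term lam a s n)"

text \<open>
  Summation by parts, with the variation of the complex weights \<open>w\<close> dominated by that of a decreasing
  real sequence \<open>v\<close>; the variation then telescopes. Real decreasing weights are the case \<open>v = w\<close>.
\<close>

lemma abel_summation_bound:
  fixes b w :: "nat \<Rightarrow> complex" and v :: "nat \<Rightarrow> real"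
  assumes b: "\<And>N. norm (\<Sum>n<N. b n) \<le> K"
    and w: "\<And>n. m \<le> n \<Longrightarrow> norm (w n) \<le> v n"
    and d: "\<And>n. m \<le> n \<Longrightarrow> norm (w (Suc n) - w n) \<le> v n - v (Suc n)"
  shows "norm (\<Sum>n=m..<N. w n * b n) \<le> 2 * K * v m"
proof (cases "m \<le> N")
  case False
  have "0 \<le> K" using b[of 0] by simp
  moreover have "0 \<le> v m" using w[of m] norm_ge_zero[of "w m"] by linarith
  ultimately show ?thesis using False by simp
next
  case True
  define B where "B n = (\<Sum>i<n. b i)" for n
  have K: "norm (B n) \<le> K" for n unfolding B_def by (rule b)
  have "0 \<le> K" using b[of 0] by simp
  have parts: "(\<Sum>n=m..<N. w n * b n)
      = w N * B N - w m * B m - (\<Sum>n=m..<N. (w (Suc n) - w n) * B (Suc n))"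
    using True by (induction N rule: dec_induct) (auto simp: B_def algebra_simps)
  have "norm (\<Sum>n=m..<N. (w (Suc n) - w n) * B (Suc n)) \<le> (\<Sum>n=m..<N. (v n - v (Suc n)) * K)"
    by (rule order_trans[OF norm_sum], rule sum_mono)
      (auto simp: norm_mult intro!: mult_mono d K order_trans[OF norm_ge_zero d])
  also have "\<dots> = (v m - v N) * K"
    using sum_Suc_diff'[OF True, of "\<lambda>n. - v n"] by (simp add: sum_distrib_right[symmetric])
  finally have 1: "norm (\<Sum>n=m..<N. (w (Suc n) - w n) * B (Suc n)) \<le> (v m - v N) * K" .
  have 2: "norm (w N * B N) \<le> v N * K" "norm (w m * B m) \<le> v m * K"
    using True by (auto simp: norm_mult intro!: mult_mono w K order_trans[OF norm_ge_zero w])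
  have "norm (\<Sum>n=m..<N. w n * b n) \<le> norm (w N * B N) + norm (w m * B m)
      + norm (\<Sum>n=m..<N. (w (Suc n) - w n) * B (Suc n))"
    unfolding parts by (rule order_trans[OF norm_triangle_ineq4 add_right_mono[OF norm_triangle_ineq4]])
  also have "\<dots> \<le> 2 * K * v m" using 1 2 by (simp add: algebra_simps)
  finally show ?thesis .
qed

text \<open>
  The derivative of \<open>exp (- x z)\<close> in \<open>x\<close> has norm \<open>|z| exp (- x Re z)\<close>, which
  is integrated from \<open>x\<close> to \<open>y\<close>. The right-hand side is a difference of values of one
  decreasing function, the form of the majorant in \<open>abel_summation_bound\<close>.
\<close>

lemma norm_exp_diff_le:
  fixes z :: complex
  assumes "0 < Re z" "x < y"
  shows "norm (exp (- (of_real y * z)) - exp (- (of_real x * z)))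
    \<le> norm z / Re z * exp (- (x * Re z)) - norm z / Re z * exp (- (y * Re z))"
proof -
  have "norm (exp (- (of_real y * z)) - exp (- (of_real x * z)))
     \<le> - (norm z / Re z * exp (- (y * Re z))) - - (norm z / Re z * exp (- (x * Re z)))"
    by (rule differentiable_bound_general[where f' = "\<lambda>x. - z * exp (- (of_real x * z))"
          and \<phi>' = "\<lambda>x. norm z * exp (- (x * Re z))"])
      (use assms in \<open>auto intro!: continuous_intros derivative_eq_intros has_vector_derivative_real_field
        simp: norm_mult has_real_derivative_iff_has_vector_derivative[symmetric]\<close>)
  then show ?thesis by simp
qed

lemma frequency_at_top:
  assumes "frequency lam" shows "filterlim lam at_top sequentially"
proof -
  have m: "strict_mono lam" and u: "\<not> bdd_above (range lam)" using assms by (auto simp: frequency_def)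
  show ?thesis
    unfolding filterlim_at_top eventually_sequentially
  proof
    fix Z
    obtain N where "Z \<le> lam N" using u unfolding bdd_above_def by (metis imageE linear)
    then show "\<exists>N. \<forall>n\<ge>N. Z \<le> lam n"
      using strict_mono_leD[OF m] by (meson order_trans)
  qed
qed

lemma frequency_less: "frequency lam \<Longrightarrow> lam n < lam (Suc n)"
  by (auto simp: frequency_def strict_mono_Suc_iff)

lemma frequency_nonneg: "frequency lam \<Longrightarrow> 0 \<le> lam n"
  by (auto simp: frequency_def)

lemma frequency_mono: "frequency lam \<Longrightarrow> m \<le> n \<Longrightarrow> lam m \<le> lam n"
  by (auto simp: frequency_def strict_mono_leD)

lemma exp_frequency_tendsto_0:
  assumes "frequency lam" "0 < c"
  shows "(\<lambda>n. exp (- (lam n * c))) \<longlonglongrightarrow> 0"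
proof -
  have "filterlim (\<lambda>n. lam n * c) at_top sequentially"
    by (rule filterlim_at_top_mult_tendsto_pos[OF tendsto_const assms(2) frequency_at_top[OF assms(1)]])
  then have "filterlim (\<lambda>n. - (lam n * c)) at_bot sequentially"
    by (simp add: filterlim_uminus_at_top)
  then show ?thesis by (rule filterlim_compose[OF exp_at_bot])
qed

lemma dirichlet_term_shift:
  "dirichlet_term lam a s n = exp (- (of_real (lam n) * (s - s0))) * dirichlet_term lam a s0 n"
  by (simp add: dirichlet_term_def mult_exp_exp algebra_simps)

text \<open>
  Moving from \<open>s0\<close> to \<open>s\<close> multiplies the terms by \<open>exp (- \<lambda>\<^sub>n (s -
  s0))\<close>. The factor \<open>|s - s0| / Re (s - s0)\<close> grows only linearly along vertical lines, which keeps
  the partial sums integrable against a Gaussian.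
\<close>

lemma tail_bound:
  assumes freq: "frequency lam" and K: "\<And>N. norm (partial_sum lam a s0 N) \<le> K"
    and s: "Re s0 < Re s"
  shows "norm (\<Sum>n=m..<N. dirichlet_term lam a s n)
    \<le> 2 * K * (norm (s - s0) / Re (s - s0)) * exp (- (lam m * Re (s - s0)))"
proof -
  define z where "z = s - s0"
  have z: "0 < Re z" using s by (simp add: z_def)
  have "1 \<le> norm z / Re z" using z complex_Re_le_cmod[of z] by simp
  then have w: "norm (exp (- (of_real x * z))) \<le> norm z / Re z * exp (- (x * Re z))" for x
    using mult_right_mono[of 1 "norm z / Re z" "exp (- (x * Re z))"] by simp
  have "norm (\<Sum>n=m..<N. exp (- (of_real (lam n) * z)) * dirichlet_term lam a s0 n)
    \<le> 2 * K * (norm z / Re z * exp (- (lam m * Re z)))"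
    by (intro abel_summation_bound[where v = "\<lambda>n. norm z / Re z * exp (- (lam n * Re z))"] K w
        norm_exp_diff_le z frequency_less freq)
  then show ?thesis
    unfolding z_def dirichlet_term_shift[symmetric] by (simp add: mult.assoc)
qed

lemma bounded_partial_sums_converges:
  assumes freq: "frequency lam" and K: "\<And>N. norm (partial_sum lam a s0 N) \<le> K"
    and s: "Re s0 < Re s"
  shows "dirichlet_converges lam a s"
  unfolding dirichlet_converges_def summable_Cauchy
proof safe
  fix e :: real assume e: "0 < e"
  define z where "z = s - s0"
  have z: "0 < Re z" using s by (simp add: z_def)
  have "(\<lambda>m. 2 * K * (norm z / Re z) * exp (- (lam m * Re z))) \<longlonglongrightarrow> 0"
    by (rule tendsto_mult_right_zero[OF exp_frequency_tendsto_0[OF freq z]])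
  then have "\<forall>\<^sub>F m in sequentially. 2 * K * (norm z / Re z) * exp (- (lam m * Re z)) < e"
    using e by (rule order_tendstoD)
  then obtain N where N: "\<And>m. N \<le> m \<Longrightarrow> 2 * K * (norm z / Re z) * exp (- (lam m * Re z)) < e"
    unfolding eventually_sequentially by auto
  show "\<exists>N. \<forall>m\<ge>N. \<forall>n. norm (sum (dirichlet_term lam a s) {m..<n}) < e"
    using le_less_trans[OF tail_bound[OF freq K s, folded z_def] N] by blast
qed

lemma dirichlet_converges_imp_bounded_partial_sums:
  assumes "dirichlet_converges lam a s"
  obtains K where "\<And>N. norm (partial_sum lam a s N) \<le> K"
  using summable_imp_sums_bounded[of "dirichlet_term lam a s"] assms
  by (auto simp: bounded_iff dirichlet_converges_def)

lemma dirichlet_converges_mono: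
  assumes "frequency lam" "dirichlet_converges lam a s0" "Re s0 < Re s"
  shows "dirichlet_converges lam a s"
  using bounded_partial_sums_converges[OF assms(1) _ assms(3)]
    dirichlet_converges_imp_bounded_partial_sums[OF assms(2)] by metis

lemma partial_sum_tendsto:
  "dirichlet_converges lam a s \<Longrightarrow> partial_sum lam a s \<longlonglongrightarrow> dirichlet_limit lam a s"
  unfolding dirichlet_converges_def dirichlet_limit_def by (rule summable_LIMSEQ)

lemma limit_tail_bound:
  assumes freq: "frequency lam" and K: "\<And>N. norm (partial_sum lam a s0 N) \<le> K"
    and s: "Re s0 < Re s"
  shows "norm (dirichlet_limit lam a s - partial_sum lam a s m)
    \<le> 2 * K * (norm (s - s0) / Re (s - s0)) * exp (- (lam m * Re (s - s0)))"
proof (rule Lim_norm_ubound[OF sequentially_bot])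
  show "(\<lambda>N. partial_sum lam a s N - partial_sum lam a s m)
      \<longlonglongrightarrow> dirichlet_limit lam a s - partial_sum lam a s m"
    by (intro tendsto_diff tendsto_const partial_sum_tendsto bounded_partial_sums_converges[OF freq K s])
  have "partial_sum lam a s N - partial_sum lam a s m = (\<Sum>n=m..<N. dirichlet_term lam a s n)"
    if "m \<le> N" for N
    using sum_diff_nat_ivl[of 0 m N "dirichlet_term lam a s"] that by (simp add: atLeast0LessThan)
  then show "\<forall>\<^sub>F N in sequentially. norm (partial_sum lam a s N - partial_sum lam a s m)
    \<le> 2 * K * (norm (s - s0) / Re (s - s0)) * exp (- (lam m * Re (s - s0)))"
    unfolding eventually_sequentially using tail_bound[OF freq K s] by (intro exI[of _ m]) simp
qed

text \<open>
  When the partial sums are bounded on a whole half-plane, the base point can be taken on the horizontal line through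
  \<open>s\<close>, so the factor \<open>|s - s0| / Re (s - s0)\<close> is 1 and the estimate is uniform.
\<close>

lemma half_plane_tail_bound:
  assumes freq: "frequency lam" and K: "\<And>s N. \<sigma> \<le> Re s \<Longrightarrow> norm (partial_sum lam a s N) \<le> K"
    and "0 < \<delta>" "\<sigma> + \<delta> \<le> Re s"
  shows "norm (dirichlet_limit lam a s - partial_sum lam a s m) \<le> 2 * K * exp (- (lam m * \<delta>))"
  using limit_tail_bound[OF freq, of a "s - of_real \<delta>" K s m] K assms by simp

lemma half_plane_uniform_limit:
  assumes freq: "frequency lam" and K: "\<And>s N. \<sigma> \<le> Re s \<Longrightarrow> norm (partial_sum lam a s N) \<le> K"
    and \<delta>: "0 < \<delta>"
  shows "uniform_limit (right_half_plane (\<sigma> + \<delta>)) (\<lambda>N s. partial_sum lam a s N)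
    (dirichlet_limit lam a) sequentially"
proof (rule uniform_limitI)
  fix e :: real assume e: "0 < e"
  have "(\<lambda>m. 2 * K * exp (- (lam m * \<delta>))) \<longlonglongrightarrow> 0"
    by (rule tendsto_mult_right_zero[OF exp_frequency_tendsto_0[OF freq \<delta>]])
  then have "\<forall>\<^sub>F m in sequentially. 2 * K * exp (- (lam m * \<delta>)) < e"
    using e by (rule order_tendstoD)
  then show "\<forall>\<^sub>F N in sequentially. \<forall>s\<in>right_half_plane (\<sigma> + \<delta>).
      dist (partial_sum lam a s N) (dirichlet_limit lam a s) < e"
  proof eventually_elim
    case (elim m)
    show ?case
    proof
      fix s assume "s \<in> right_half_plane (\<sigma> + \<delta>)"
      then have "norm (dirichlet_limit lam a s - partial_sum lam a s m) \<le> 2 * K * exp (- (lam m * \<delta>))"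
        by (intro half_plane_tail_bound[OF freq K \<delta>]) auto
      then show "dist (partial_sum lam a s m) (dirichlet_limit lam a s) < e"
        using elim by (simp add: dist_norm norm_minus_commute)
    qed
  qed
qed

lemma dirichlet_term_holomorphic: "(\<lambda>s. dirichlet_term lam a s n) holomorphic_on S"
  unfolding dirichlet_term_def by (intro holomorphic_intros)

lemma dirichlet_limit_holomorphic:
  assumes freq: "frequency lam" and c: "dirichlet_converges lam a s0"
  shows "dirichlet_limit lam a holomorphic_on right_half_plane (Re s0)"
proof (rule holomorphic_uniform_sequence[where f = "\<lambda>N s. partial_sum lam a s N"])
  show "open (right_half_plane (Re s0))" by (rule open_halfspace_Re_gt)
  show "(\<lambda>s. partial_sum lam a s N) holomorphic_on right_half_plane (Re s0)" for N
    by (intro holomorphic_on_sum dirichlet_term_holomorphic)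
  \<comment> \<open>Near \<open>x\<close> both \<open>|s - s0|\<close> and \<open>1 / Re (s - s0)\<close> are bounded, so the tail estimate is locally uniform.\<close>
  obtain K where K: "\<And>N. norm (partial_sum lam a s0 N) \<le> K"
    using dirichlet_converges_imp_bounded_partial_sums[OF c] by blast
  have "0 \<le> K" using K[of 0] by simp
  fix x assume "x \<in> right_half_plane (Re s0)"
  then have x: "Re s0 < Re x" by simp
  define d where "d = (Re x - Re s0) / 2"
  have d: "0 < d" using x by (simp add: d_def)
  have far: "d \<le> Re (s - s0)" if "s \<in> cball x d" for s
    using that complex_Re_le_cmod[of "x - s"] by (simp add: d_def dist_norm field_simps)
  have near: "norm (s - s0) \<le> norm (x - s0) + d" if "s \<in> cball x d" for s
  proof -
    have "norm (s - s0) \<le> norm (s - x) + norm (x - s0)"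
      using norm_triangle_ineq[of "s - x" "x - s0"] by simp
    then show ?thesis using that by (simp add: dist_norm norm_minus_commute)
  qed
  define C where "C = 2 * K * ((norm (x - s0) + d) / d)"
  have "norm (dirichlet_limit lam a s - partial_sum lam a s m) \<le> C * exp (- (lam m * d))"
    if s: "s \<in> cball x d" for s m
  proof -
    have pos: "0 < Re (s - s0)" using far[OF s] d by linarith
    have "norm (dirichlet_limit lam a s - partial_sum lam a s m)
        \<le> 2 * K * (norm (s - s0) / Re (s - s0)) * exp (- (lam m * Re (s - s0)))"
      by (rule limit_tail_bound[OF freq K]) (use pos in simp)
    also have "\<dots> \<le> C * exp (- (lam m * d))"
      unfolding C_def
      by (intro mult_mono frac_le near far s) 
        (use d pos \<open>0 \<le> K\<close> far[OF s] frequency_nonneg[OF freq] in \<open>auto intro!: mult_nonneg_nonneg mult_left_mono add_nonneg_nonneg divide_nonneg_nonneg simp del: minus_complex.sel\<close>)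
    finally show ?thesis .
  qed
  note bd = this
  have "uniform_limit (cball x d) (\<lambda>N s. partial_sum lam a s N) (dirichlet_limit lam a) sequentially"
  proof (rule uniform_limitI)
    fix e :: real assume e: "0 < e"
    have "(\<lambda>m. C * exp (- (lam m * d))) \<longlonglongrightarrow> 0"
      by (rule tendsto_mult_right_zero[OF exp_frequency_tendsto_0[OF freq d]])
    then have "\<forall>\<^sub>F m in sequentially. C * exp (- (lam m * d)) < e"
      using e by (rule order_tendstoD)
    then show "\<forall>\<^sub>F N in sequentially. \<forall>s\<in>cball x d.
        dist (partial_sum lam a s N) (dirichlet_limit lam a s) < e"
      by eventually_elim (use bd in \<open>force simp: dist_norm norm_minus_commute intro: le_less_trans\<close>)
  qed
  then show "\<exists>d>0. cball x d \<subseteq> right_half_plane (Re s0) \<and>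
      uniform_limit (cball x d) (\<lambda>N s. partial_sum lam a s N) (dirichlet_limit lam a) sequentially"
    using d far by (intro exI[of _ d]) fastforce
qed

section \<open>Gaussian means of Dirichlet series\<close>

text \<open>
  Up to scaling of the argument, the characteristic function of the standard normal distribution.
\<close>

definition gauss_weight :: "real \<Rightarrow> real \<Rightarrow> real" where
  "gauss_weight R x = exp (- ((R * x)\<^sup>2 / 2))"

interpretation std_normal: real_distribution std_normal_distribution
  by (rule real_dist_normal_dist)

lemma norm_gaussian_mean_le:
  fixes f :: "real \<Rightarrow> complex"
  assumes "\<And>t. norm (f t) \<le> M"
  shows "norm (LINT t|std_normal_distribution. f t) \<le> M"
proof -
  have "0 \<le> M" using assms[of 0] norm_ge_zero order_trans by blast
  have "norm (LINT t|std_normal_distribution. f t) \<le> (LINT t|std_normal_distribution. norm (f t))"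
    by (rule integral_norm_bound)
  also have "\<dots> \<le> (LINT t|std_normal_distribution. M)"
    by (rule integral_mono') (use assms \<open>0 \<le> M\<close> in auto)
  also have "\<dots> = M" using std_normal.prob_space by simp
  finally show ?thesis .
qed

lemma dirichlet_term_vertical:
  "iexp (\<mu> * R * t) * dirichlet_term lam a (s + \<i> * of_real (R * t)) n
   = dirichlet_term lam a s n * iexp (R * (\<mu> - lam n) * t)"
  by (simp add: dirichlet_term_def mult_exp_exp algebra_simps)

text \<open>
  Averaging a limit function along a vertical line with a Gaussian, after modulation by the frequency
  \<open>\<mu>\<close>, multiplies the \<open>n\<close>-th term by a Gaussian in \<open>\<mu> -
  \<lambda>\<^sub>n\<close>. For partial sums this is the formula for the characteristic function; the limit is taken
  by dominated convergence, with the linear bound from \<open>tail_bound\<close> as majorant.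
\<close>

lemma gaussian_mean_dirichlet:
  assumes freq: "frequency lam" and c: "dirichlet_converges lam a s0" and s: "Re s0 < Re s"
  shows "(\<lambda>n. dirichlet_term lam a s n * of_real (gauss_weight R (\<mu> - lam n))) sums
    (LINT t|std_normal_distribution. iexp (\<mu> * R * t) * dirichlet_limit lam a (s + \<i> * of_real (R * t)))"
proof -
  define T where "T N t = iexp (\<mu> * R * t) * partial_sum lam a (s + \<i> * of_real (R * t)) N" for N t
  obtain K where K: "\<And>N. norm (partial_sum lam a s0 N) \<le> K"
    using dirichlet_converges_imp_bounded_partial_sums[OF c] by blast
  have K0: "0 \<le> K" using K[of 0] by simp
  define w where "w t = 2 * K * ((norm (s - s0) + \<bar>R\<bar> * \<bar>t\<bar>) / (Re s - Re s0))" for t :: real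
  have meas: "T N \<in> borel_measurable std_normal_distribution" for N
  proof -
    have "continuous_on UNIV (T N)"
      unfolding T_def dirichlet_term_def by (intro continuous_intros)
    then show ?thesis
      by (simp add: borel_measurable_continuous_onI)
  qed
  have lim: "(\<lambda>N. T N t) \<longlonglongrightarrow> iexp (\<mu> * R * t) * dirichlet_limit lam a (s + \<i> * of_real (R * t))" for t
    unfolding T_def
    by (intro tendsto_intros partial_sum_tendsto dirichlet_converges_mono[OF freq c]) (use s in simp)
  have meas': "(\<lambda>t. iexp (\<mu> * R * t) * dirichlet_limit lam a (s + \<i> * of_real (R * t)))
      \<in> borel_measurable std_normal_distribution"
    by (rule borel_measurable_LIMSEQ_metric[OF meas]) (rule lim)
  have "integrable std_normal_distribution (\<lambda>t. \<bar>t\<bar>)"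
    using integrable_abs[OF integrable_std_normal_distribution_moment[of 1]] by simp
  then have w_int: "integrable std_normal_distribution w"
    unfolding w_def by simp
  have bound: "norm (T N t) \<le> w t" for N t
  proof -
    let ?z = "s + \<i> * of_real (R * t)"
    have "norm (T N t) = norm (\<Sum>n=0..<N. dirichlet_term lam a ?z n)"
      by (simp add: T_def norm_mult atLeast0LessThan)
    also have "\<dots> \<le> 2 * K * (norm (?z - s0) / Re (?z - s0)) * exp (- (lam 0 * Re (?z - s0)))"
      by (rule tail_bound[OF freq K]) (use s in simp)
    also have "\<dots> \<le> 2 * K * (norm (?z - s0) / Re (?z - s0)) * 1"
      by (intro mult_left_mono) (use s K0 frequency_nonneg[OF freq, of 0] in auto)
    also have "\<dots> \<le> w t"
    proof -
      have "norm (?z - s0) \<le> norm (s - s0) + norm (\<i> * of_real (R * t))"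
        using norm_triangle_ineq[of "s - s0" "\<i> * of_real (R * t)"] by (simp add: algebra_simps)
      then have "norm (?z - s0) \<le> norm (s - s0) + \<bar>R\<bar> * \<bar>t\<bar>"
        by (simp add: norm_mult abs_mult)
      then show ?thesis
        unfolding w_def using s K0 by (auto intro!: mult_left_mono divide_right_mono)
    qed
    finally show ?thesis .
  qed
  have "(\<lambda>N. LINT t|std_normal_distribution. T N t) \<longlonglongrightarrow>
    (LINT t|std_normal_distribution. iexp (\<mu> * R * t) * dirichlet_limit lam a (s + \<i> * of_real (R * t)))"
    by (rule integral_dominated_convergence[where w = w]) (use meas meas' w_int lim bound in auto)
  moreover have "(LINT t|std_normal_distribution. T N t)
      = (\<Sum>n<N. dirichlet_term lam a s n * of_real (gauss_weight R (\<mu> - lam n)))" for N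
  proof -
    have T_eq: "T N = (\<lambda>t. \<Sum>n<N. dirichlet_term lam a s n * iexp (R * (\<mu> - lam n) * t))"
      unfolding T_def sum_distrib_left dirichlet_term_vertical ..
    have char: "(LINT t|std_normal_distribution. iexp (R * (\<mu> - lam n) * t))
        = of_real (gauss_weight R (\<mu> - lam n))" for n
      using fun_cong[OF char_std_normal_distribution, of "R * (\<mu> - lam n)"]
      by (simp add: char_def gauss_weight_def)
    have int: "integrable std_normal_distribution (\<lambda>t. iexp (R * (\<mu> - lam n) * t))" for n
      by (intro std_normal.integrable_iexp) auto
    have "(LINT t|std_normal_distribution. T N t)
        = (\<Sum>n<N. LINT t|std_normal_distribution. dirichlet_term lam a s n * iexp (R * (\<mu> - lam n) * t))"
      unfolding T_eq by (intro Bochner_Integration.integral_sum integrable_mult_right int)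
    then show ?thesis
      unfolding integral_mult_right_zero char .
  qed
  ultimately show ?thesis unfolding sums_def by simp
qed

lemma gauss_weight_tendsto_0:
  assumes "x \<noteq> 0"
  shows "(\<lambda>j. gauss_weight (real j) x) \<longlonglongrightarrow> 0"
proof -
  have "filterlim (\<lambda>j. real j * (real j * (x\<^sup>2 / 2))) at_top sequentially"
    by (intro filterlim_at_top_mult_at_top filterlim_real_sequentially
        filterlim_at_top_mult_tendsto_pos[OF tendsto_const]) (use assms in auto)
  then have "filterlim (\<lambda>j. - ((real j * x)\<^sup>2 / 2)) at_bot sequentially"
    by (simp add: filterlim_uminus_at_top power2_eq_square mult_ac)
  then show ?thesis unfolding gauss_weight_def by (rule filterlim_compose[OF exp_at_bot])
qed

lemma gauss_weight_antimono: "\<bar>x\<bar> \<le> \<bar>y\<bar> \<Longrightarrow> gauss_weight R y \<le> gauss_weight R x"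
  using mult_left_mono[of "x\<^sup>2" "y\<^sup>2" "R\<^sup>2"]
  by (simp add: gauss_weight_def power_mult_distrib abs_le_square_iff)

text \<open>
  In the Gaussian mean modulated by \<open>\<lambda>\<^sub>m\<close> the weight of the \<open>m\<close>-th term is 1,
  and as \<open>R \<rightarrow> \<infinity>\<close> all other weights tend to 0. The terms beyond \<open>m\<close>
  need not be absolutely summable, but their weights decrease, so Abel summation controls them by the first weight
  \<open>g R (m + 1)\<close>.
\<close>

lemma coefficient_bound:
  assumes freq: "frequency lam" and c: "dirichlet_converges lam a s0" and x: "Re s0 < x"
    and M: "\<And>s. Re s = x \<Longrightarrow> norm (dirichlet_limit lam a s) \<le> M"
  shows "norm (a m) \<le> M * exp (lam m * x)"
proof -
  define b where "b = dirichlet_term lam a (of_real x)"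
  have "dirichlet_converges lam a (of_real x)"
    by (rule dirichlet_converges_mono[OF freq c]) (use x in simp)
  then obtain K where K: "\<And>N. norm (\<Sum>n<N. b n) \<le> K"
    unfolding b_def using dirichlet_converges_imp_bounded_partial_sums by blast
  define g where "g R n = gauss_weight R (lam m - lam n)" for R n
  define S where "S R N = (\<Sum>n<N. b n * of_real (g R n))" for R N
  have tail: "norm (S R N - S R (Suc m)) \<le> 2 * K * g R (Suc m)" if "Suc m \<le> N" for R N
  proof -
    have dec: "g R (Suc n) \<le> g R n" if "Suc m \<le> n" for n
      unfolding g_def using that frequency_mono[OF freq, of m n] frequency_less[OF freq, of n]
      by (intro gauss_weight_antimono) simp
    have "S R N - S R (Suc m) = (\<Sum>n=Suc m..<N. of_real (g R n) * b n)"
      using sum_diff_nat_ivl[of 0 "Suc m" N "\<lambda>n. b n * of_real (g R n)"] that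
      by (simp add: S_def atLeast0LessThan mult.commute)
    also have "norm \<dots> \<le> 2 * K * g R (Suc m)"
    proof (rule abel_summation_bound[OF K])
      show "norm (complex_of_real (g R n)) \<le> g R n" for n
        by (simp add: g_def gauss_weight_def)
      show "norm (complex_of_real (g R (Suc n)) - complex_of_real (g R n)) \<le> g R n - g R (Suc n)"
        if "Suc m \<le> n" for n
        using dec[OF that] by (simp flip: of_real_diff)
    qed
    finally show ?thesis .
  qed
  have head: "norm (S R (Suc m)) \<le> M + 2 * K * g R (Suc m)" for R
  proof -
    let ?I = "LINT t|std_normal_distribution. iexp (lam m * R * t)
      * dirichlet_limit lam a (of_real x + \<i> * of_real (R * t))"
    have "S R \<longlonglongrightarrow> ?I"
      using gaussian_mean_dirichlet[OF freq c, of "of_real x" R "lam m"] x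
      by (simp add: sums_def S_def[abs_def] b_def g_def)
    then have "(\<lambda>N. S R N - S R (Suc m)) \<longlonglongrightarrow> ?I - S R (Suc m)"
      by (intro tendsto_intros)
    then have "norm (?I - S R (Suc m)) \<le> 2 * K * g R (Suc m)"
      by (rule Lim_norm_ubound[OF sequentially_bot])
        (use tail in \<open>auto simp: eventually_sequentially intro!: exI[of _ "Suc m"]\<close>)
    moreover have "norm ?I \<le> M"
      by (rule norm_gaussian_mean_le) (use M in \<open>simp add: norm_mult\<close>)
    ultimately show ?thesis
      using norm_triangle_ineq2[of "S R (Suc m)" ?I] by (simp add: norm_minus_commute)
  qed
  have "(\<lambda>j. S (real j) (Suc m)) \<longlonglongrightarrow> (\<Sum>n<Suc m. b n * of_real (if n = m then 1 else 0))"
    unfolding S_def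
  proof (intro tendsto_sum tendsto_mult tendsto_const tendsto_of_real)
    fix n assume "n \<in> {..<Suc m}"
    then have "n \<noteq> m \<Longrightarrow> lam m - lam n \<noteq> 0"
      using freq by (auto simp: frequency_def strict_mono_eq)
    then show "(\<lambda>j. g (real j) n) \<longlonglongrightarrow> (if n = m then 1 else 0)"
      by (auto simp: g_def gauss_weight_tendsto_0) (simp add: gauss_weight_def)
  qed
  then have "(\<lambda>j. S (real j) (Suc m)) \<longlonglongrightarrow> b m" by simp
  moreover have "(\<lambda>j. M + 2 * K * g (real j) (Suc m)) \<longlonglongrightarrow> M + 2 * K * 0"
    unfolding g_def using frequency_less[OF freq, of m]
    by (intro tendsto_intros gauss_weight_tendsto_0) simp
  ultimately have "norm (b m) \<le> M + 2 * K * 0"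
    using head by (intro tendsto_le[OF sequentially_bot _ tendsto_norm]) auto
  then have "norm (a m) * exp (- (lam m * x)) \<le> M"
    by (simp add: b_def dirichlet_term_def norm_mult)
  then show ?thesis by (simp add: exp_minus field_simps)
qed

definition gauss_smooth :: "(nat \<Rightarrow> real) \<Rightarrow> real \<Rightarrow> (nat \<Rightarrow> complex) \<Rightarrow> nat \<Rightarrow> complex" where
  "gauss_smooth lam R a n = a n * of_real (gauss_weight R (lam n))"

text \<open>
  The Gaussian factor decreases faster than any exponential increases, so the half-plane of convergence
  becomes the whole plane. No absolute convergence is available, since the frequency may grow
  arbitrarily slowly; the point is that the combined weights are eventually decreasing.
\<close>

lemma gauss_smooth_converges:
  assumes freq: "frequency lam" and c: "dirichlet_converges lam a s0" and R: "0 < R"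
  shows "dirichlet_converges lam (gauss_smooth lam R a) s"
proof -
  \<comment> \<open>The point \<open>s1\<close> lies one unit to the left of \<open>s\<close>, and on the same horizontal line as
    \<open>s0\<close>, so that the weights are real.\<close>
  define x where "x = Re s0 - Re s + 1"
  define s1 where "s1 = s0 - of_real x"
  define w where "w n = exp (lam n * x - (R * lam n)\<^sup>2 / 2)" for n
  obtain K where K: "\<And>N. norm (partial_sum lam a s0 N) \<le> K"
    using dirichlet_converges_imp_bounded_partial_sums[OF c] by blast
  have term_eq: "dirichlet_term lam (gauss_smooth lam R a) s1 n
      = of_real (w n) * dirichlet_term lam a s0 n" for n
    by (simp add: dirichlet_term_def gauss_smooth_def gauss_weight_def w_def s1_def
        exp_of_real[symmetric] mult_exp_exp algebra_simps)
  \<comment> \<open>The exponent \<open>x y - R\<^sup>2 y\<^sup>2 / 2\<close> decreases in \<open>y\<close> from \<open>y = x / R\<^sup>2\<close> on.\<close>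
  obtain m where m: "\<And>n. m \<le> n \<Longrightarrow> x / R\<^sup>2 \<le> lam n"
    using frequency_at_top[OF freq] unfolding filterlim_at_top eventually_sequentially by blast
  have dec: "w (Suc n) \<le> w n" if "m \<le> n" for n
  proof -
    have le: "lam n \<le> lam (Suc n)" by (simp add: frequency_mono[OF freq])
    have "x \<le> R\<^sup>2 * lam n" using m[OF that] R by (simp add: field_simps)
    moreover have "R\<^sup>2 * lam n \<le> R\<^sup>2 * lam (Suc n)" using le by (simp add: mult_left_mono)
    ultimately have "0 \<le> R\<^sup>2 * (lam n + lam (Suc n)) / 2 - x" by (simp add: algebra_simps)
    then have "0 \<le> (lam (Suc n) - lam n) * (R\<^sup>2 * (lam n + lam (Suc n)) / 2 - x)"
      using le by simp
    then show ?thesis unfolding w_def by (simp add: power2_eq_square field_simps)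
  qed
  have tail: "norm (\<Sum>n=m..<N. of_real (w n) * dirichlet_term lam a s0 n) \<le> 2 * K * w m" for N
  proof (rule abel_summation_bound[OF K])
    show "norm (complex_of_real (w n)) \<le> w n" for n by (simp add: w_def)
    show "norm (complex_of_real (w (Suc n)) - complex_of_real (w n)) \<le> w n - w (Suc n)"
      if "m \<le> n" for n
      using dec[OF that] by (simp flip: of_real_diff)
  qed
  let ?d = "dirichlet_term lam (gauss_smooth lam R a) s1"
  have "norm (partial_sum lam (gauss_smooth lam R a) s1 N) \<le> (\<Sum>n<m. norm (?d n)) + 2 * K * w m" for N
  proof -
    have "{..<N} = {..<min m N} \<union> {m..<N}" by auto
    then have "sum ?d {..<N} = sum ?d {..<min m N} + sum ?d {m..<N}"
      by (metis (no_types, lifting) finite_lessThan finite_atLeastLessThan sum.union_disjoint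
          disjoint_iff atLeastLessThan_iff lessThan_iff min_less_iff_conj not_le)
    moreover have "norm (sum ?d {..<min m N}) \<le> (\<Sum>n<m. norm (?d n))"
      by (rule order_trans[OF norm_sum]) (rule sum_mono2, auto)
    moreover have "norm (sum ?d {m..<N}) \<le> 2 * K * w m"
      using tail[of N] by (simp add: term_eq)
    ultimately show ?thesis
      using norm_triangle_ineq[of "sum ?d {..<min m N}" "sum ?d {m..<N}"] by simp
  qed
  then show ?thesis
    by (rule bounded_partial_sums_converges[OF freq]) (simp add: s1_def x_def)
qed

text \<open>
  Differentiation under the integral sign. By the Cauchy inequality a bounded holomorphic function is
  Lipschitz continuous on small balls, with a constant that depends only on the distance to the
  boundary of the half-plane; this dominates all difference quotients at once.
\<close>

lemma gaussian_mean_holomorphic: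
  assumes holf: "f holomorphic_on right_half_plane 0"
    and M: "\<And>s. 0 < Re s \<Longrightarrow> norm (f s) \<le> M"
  shows "(\<lambda>s. LINT t|std_normal_distribution. f (s + \<i> * of_real (R * t)))
    holomorphic_on right_half_plane 0"
proof -
  have op: "open (right_half_plane 0)" by (rule open_halfspace_Re_gt)
  have cmeas: "(\<lambda>t. g (s + \<i> * of_real (R * t))) \<in> borel_measurable std_normal_distribution"
    if "g holomorphic_on right_half_plane 0" "0 < Re s" for g s
  proof -
    have "continuous_on UNIV (\<lambda>t. g (s + \<i> * of_real (R * t)))"
      by (rule continuous_on_compose2[OF holomorphic_on_imp_continuous_on[OF that(1)]])
        (use that(2) in \<open>auto intro!: continuous_intros\<close>)
    then show ?thesis by (simp add: borel_measurable_continuous_onI)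
  qed
  have int: "integrable std_normal_distribution (\<lambda>t. f (s + \<i> * of_real (R * t)))" if "0 < Re s" for s
    by (rule std_normal.integrable_const_bound[where B = M]) (use that M cmeas holf in auto)
  have "((\<lambda>s. LINT t|std_normal_distribution. f (s + \<i> * of_real (R * t)))
      has_field_derivative (LINT t|std_normal_distribution. deriv f (z + \<i> * of_real (R * t)))) (at z)"
    if z: "0 < Re z" for z
  proof -
    define r where "r = Re z / 3"
    have r: "0 < r" using z by (simp add: r_def)
    have in_ball: "2 * r < Re y" if "y \<in> ball z r" for y
      using that complex_Re_le_cmod[of "z - y"] by (simp add: r_def dist_norm)
    have der: "norm (deriv f \<xi>) \<le> M / r" if "2 * r < Re \<xi>" for \<xi>
    proof -
      have sub: "cball \<xi> r \<subseteq> right_half_plane 0"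
      proof
        fix y assume "y \<in> cball \<xi> r"
        then show "y \<in> right_half_plane 0"
          using that r complex_Re_le_cmod[of "\<xi> - y"] by (simp add: dist_norm)
      qed
      have "norm ((deriv ^^ 1) f \<xi>) \<le> fact 1 * M / r ^ 1"
      proof (rule Cauchy_inequality[OF _ _ r])
        show "f holomorphic_on ball \<xi> r"
          by (rule holomorphic_on_subset[OF holf]) (use sub ball_subset_cball in blast)
        show "continuous_on (cball \<xi> r) f"
          using holomorphic_on_imp_continuous_on[OF holf] sub continuous_on_subset by blast
        show "norm (f x) \<le> M" if "norm (\<xi> - x) = r" for x
          using sub that by (intro M) (auto simp: dist_norm subset_iff)
      qed
      then show ?thesis by simp
    qed
    have lip: "norm (f (y + w) - f (z + w)) \<le> M / r * norm (y - z)"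
      if y: "y \<in> ball z r" and w: "Re w = 0" for y w
    proof -
      have pos: "2 * r < Re u" if "u \<in> ball (z + w) r" for u
        using in_ball[of "u - w"] that w by (simp add: dist_norm algebra_simps)
      have "norm (f (y + w) - f (z + w)) \<le> M / r * norm (y + w - (z + w))"
      proof (rule field_differentiable_bound[of "ball (z + w) r" f "deriv f"])
        fix u assume "u \<in> ball (z + w) r"
        note pu = pos[OF this]
        show "(f has_field_derivative deriv f u) (at u within ball (z + w) r)"
          by (rule has_field_derivative_at_within, rule holomorphic_derivI[OF holf op])
            (use pu r in simp)
        show "norm (deriv f u) \<le> M / r" by (rule der[OF pu])
      qed (use y r in \<open>auto simp: dist_norm\<close>)
      then show ?thesis by simp
    qed
    have "((\<lambda>s. LINT t|std_normal_distribution. f (s + \<i> * of_real (R * t)))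
      has_field_derivative (LINT t|std_normal_distribution. deriv f (z + \<i> * of_real (R * t))))
        (at z within ball z r)"
      unfolding has_field_derivative_iff tendsto_at_iff_sequentially comp_def
    proof (intro allI impI)
      fix X assume X: "\<forall>i. X i \<in> ball z r - {z}" and Xz: "X \<longlonglongrightarrow> z"
      let ?q = "\<lambda>i t. (f (X i + \<i> * of_real (R * t)) - f (z + \<i> * of_real (R * t))) / (X i - z)"
      have Xpos: "0 < Re (X i)" for i using in_ball[of "X i"] X r by force
      have "(\<lambda>i. LINT t|std_normal_distribution. ?q i t)
        \<longlonglongrightarrow> (LINT t|std_normal_distribution. deriv f (z + \<i> * of_real (R * t)))"
      proof (rule integral_dominated_convergence[where w = "\<lambda>_. M / r"])
        show "(\<lambda>t. deriv f (z + \<i> * of_real (R * t))) \<in> borel_measurable std_normal_distribution"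
          by (rule cmeas[OF holomorphic_deriv[OF holf op] z])
        show "?q i \<in> borel_measurable std_normal_distribution" for i
          by (intro borel_measurable_divide borel_measurable_diff cmeas[OF holf z] cmeas[OF holf Xpos]) auto
        show "AE t in std_normal_distribution. (\<lambda>i. ?q i t) \<longlonglongrightarrow> deriv f (z + \<i> * of_real (R * t))"
        proof (rule AE_I2)
          fix t
          let ?w = "\<i> * complex_of_real (R * t)"
          have "(f has_field_derivative deriv f (z + ?w)) (at (z + ?w))"
            by (rule holomorphic_derivI[OF holf op]) (use z in simp)
          then have "((\<lambda>y. f (y + ?w)) has_field_derivative deriv f (z + ?w)) (at z)"
            by (simp add: DERIV_shift)
          then show "(\<lambda>i. ?q i t) \<longlonglongrightarrow> deriv f (z + ?w)"
            unfolding has_field_derivative_iff tendsto_at_iff_sequentially comp_def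
            using X Xz by auto
        qed
        show "AE t in std_normal_distribution. norm (?q i t) \<le> M / r" for i
        proof (rule AE_I2)
          fix t
          show "norm (?q i t) \<le> M / r"
            using lip[of "X i" "\<i> * complex_of_real (R * t)"] X
            by (simp add: norm_divide divide_le_eq)
        qed
      qed auto
      moreover have "(LINT t|std_normal_distribution. ?q i t)
        = ((LINT t|std_normal_distribution. f (X i + \<i> * of_real (R * t)))
          - (LINT t|std_normal_distribution. f (z + \<i> * of_real (R * t)))) / (X i - z)" for i
        by (simp only: integral_divide_zero Bochner_Integration.integral_diff[OF int[OF Xpos] int[OF z]])
      ultimately show "(\<lambda>i. ((LINT t|std_normal_distribution. f (X i + \<i> * of_real (R * t)))
          - (LINT t|std_normal_distribution. f (z + \<i> * of_real (R * t)))) / (X i - z))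
        \<longlonglongrightarrow> (LINT t|std_normal_distribution. deriv f (z + \<i> * of_real (R * t)))"
        by (simp only:)
    qed
    then show ?thesis using at_within_open[of z "ball z r"] r by simp
  qed
  then show ?thesis
    unfolding holomorphic_on_open[OF op] by auto
qed

text \<open>
  Far to the right \<open>f\<close> is the limit function, so there its Gaussian mean is the limit function of the
  smoothed series. Both sides are holomorphic on \<open>[Re > 0]\<close> and agree there by analytic continuation,
  and a mean of \<open>f\<close> is bounded by \<open>sup |f|\<close>.
\<close>

lemma gauss_smooth_limit_bound:
  assumes freq: "frequency lam" and c: "dirichlet_converges lam a s0" and R: "0 < R"
    and holf: "f holomorphic_on right_half_plane 0"
    and M: "\<And>s. 0 < Re s \<Longrightarrow> norm (f s) \<le> M"
    and eq: "\<And>s. 0 < Re s \<Longrightarrow> Re s0 < Re s \<Longrightarrow> f s = dirichlet_limit lam a s"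
    and s: "0 < Re s"
  shows "norm (dirichlet_limit lam (gauss_smooth lam R a) s) \<le> M"
proof -
  define h where "h s = (LINT t|std_normal_distribution. f (s + \<i> * of_real (R * t)))" for s
  have "dirichlet_limit lam (gauss_smooth lam R a) s = h s"
  proof (rule analytic_continuation_open[where f = "dirichlet_limit lam (gauss_smooth lam R a)" and g = h])
    show "open (right_half_plane (max 0 (Re s0)))" "open (right_half_plane 0)"
      by (rule open_halfspace_Re_gt)+
    show "right_half_plane (max 0 (Re s0)) \<noteq> {}" by (rule right_half_plane_nonempty)
    show "connected (right_half_plane 0)"
      by (intro convex_connected convex_halfspace_Re_gt)
    show "right_half_plane (max 0 (Re s0)) \<subseteq> right_half_plane 0" by auto
    show "dirichlet_limit lam (gauss_smooth lam R a) holomorphic_on right_half_plane 0"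
      using dirichlet_limit_holomorphic[OF freq gauss_smooth_converges[OF freq c R, of 0]] by simp
    show "h holomorphic_on right_half_plane 0"
      unfolding h_def by (rule gaussian_mean_holomorphic[OF holf M])
    show "s \<in> right_half_plane 0" using s by simp
    fix z assume "z \<in> right_half_plane (max 0 (Re s0))"
    then have z: "0 < Re z" "Re s0 < Re z" by auto
    have "dirichlet_limit lam (gauss_smooth lam R a) z
      = (\<Sum>n. dirichlet_term lam a z n * of_real (gauss_weight R (0 - lam n)))"
      unfolding dirichlet_limit_def
      by (rule suminf_cong) (simp add: dirichlet_term_def gauss_smooth_def gauss_weight_def)
    also have "\<dots> = (LINT t|std_normal_distribution. iexp (0 * R * t) * dirichlet_limit lam a (z + \<i> * of_real (R * t)))"
      by (rule sums_unique[symmetric, OF gaussian_mean_dirichlet[OF freq c z(2)]])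
    also have "\<dots> = h z"
      unfolding h_def by (rule Bochner_Integration.integral_cong) (use z eq in auto)
    finally show "dirichlet_limit lam (gauss_smooth lam R a) z = h z" .
  qed
  then show ?thesis
    unfolding h_def using norm_gaussian_mean_le[of "\<lambda>t. f (s + \<i> * of_real (R * t))" M] M s by simp
qed

section \<open>The seminorms and the topology of the space\<close>

text \<open>
  The coefficients of the translated series \<open>s \<mapsto> D(s + w)\<close>.
\<close>

definition coeff_shift :: "(nat \<Rightarrow> real) \<Rightarrow> complex \<Rightarrow> (nat \<Rightarrow> complex) \<Rightarrow> nat \<Rightarrow> complex" where
  "coeff_shift lam w a n = a n * exp (- (of_real (lam n) * w))"

lemma dirichlet_term_coeff_shift:
  "dirichlet_term lam (coeff_shift lam w a) s = dirichlet_term lam a (s + w)"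
  by (auto simp: fun_eq_iff dirichlet_term_def coeff_shift_def mult_exp_exp algebra_simps)

lemma dirichlet_limit_coeff_shift:
  "dirichlet_limit lam (coeff_shift lam w a) s = dirichlet_limit lam a (s + w)"
  by (simp add: dirichlet_limit_def dirichlet_term_coeff_shift)

lemma dirichlet_term_diff:
  "dirichlet_term lam (a - b) s n = dirichlet_term lam a s n - dirichlet_term lam b s n"
  by (simp add: dirichlet_term_def algebra_simps)

lemma D_infty_plus_converges:
  "a \<in> D_infty_plus lam \<Longrightarrow> 0 < Re s \<Longrightarrow> dirichlet_converges lam a s"
  by (simp add: D_infty_plus_def)

lemma inverse_nat_less:
  fixes \<sigma> :: real
  assumes "0 < \<sigma>" obtains k :: nat where "1 \<le> k" "1 / real k < \<sigma>"
proof -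
  obtain n where "1 / real (Suc n) < \<sigma>" using nat_approx_posE[OF assms] .
  then show thesis by (intro that[of "Suc n"]) auto
qed

lemma D_infty_plusI:
  assumes "\<And>s. 0 < Re s \<Longrightarrow> dirichlet_converges lam a s"
    and "\<And>k s. 1 \<le> k \<Longrightarrow> 1 / real k < Re s \<Longrightarrow> norm (dirichlet_limit lam a s) \<le> B k"
  shows "a \<in> D_infty_plus lam"
  unfolding D_infty_plus_def
proof (safe intro!: assms(1))
  fix \<sigma> :: real assume "0 < \<sigma>"
  then obtain k :: nat where "1 \<le> k" "1 / real k < \<sigma>" by (rule inverse_nat_less)
  then have "norm (dirichlet_limit lam a s) \<le> B k" if "\<sigma> < Re s" for s
    using assms(2) that by force
  then show "bounded (dirichlet_limit lam a ` right_half_plane \<sigma>)"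
    by (auto simp: bounded_iff)
qed

lemma D_infty_plus_norm_le:
  assumes "\<And>s. 1 / real k < Re s \<Longrightarrow> norm (dirichlet_limit lam a s) \<le> M"
  shows "D_infty_plus_norm lam k a \<le> M"
  unfolding D_infty_plus_norm_def
  by (rule cSUP_least[OF right_half_plane_nonempty]) (use assms in auto)

lemma dirichlet_limit_le_norm:
  assumes "a \<in> D_infty_plus lam" "1 \<le> k" "1 / real k < Re s"
  shows "norm (dirichlet_limit lam a s) \<le> D_infty_plus_norm lam k a"
  unfolding D_infty_plus_norm_def
  by (rule cSUP_upper[OF _ D_infty_plus_norm_bdd[OF assms(1,2)]]) (use assms in auto)

lemma D_infty_plus_norm_nonneg:
  assumes "a \<in> D_infty_plus lam" "1 \<le> k"
  shows "0 \<le> D_infty_plus_norm lam k a"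
  by (rule order_trans[OF norm_ge_zero dirichlet_limit_le_norm[OF assms, of "of_real (1 / real k + 1)"]])
    simp

lemma D_infty_plus_norm_mono:
  assumes "a \<in> D_infty_plus lam" "1 \<le> j" "j \<le> k"
  shows "D_infty_plus_norm lam j a \<le> D_infty_plus_norm lam k a"
proof (rule D_infty_plus_norm_le)
  fix s assume "1 / real j < Re s"
  moreover have "1 / real k \<le> 1 / real j" using assms by (simp add: frac_le)
  ultimately show "norm (dirichlet_limit lam a s) \<le> D_infty_plus_norm lam k a"
    using assms by (intro dirichlet_limit_le_norm) auto
qed

lemma D_infty_plus_diff:
  assumes "a \<in> D_infty_plus lam" "b \<in> D_infty_plus lam"
  shows "a - b \<in> D_infty_plus lam"
proof -
  interpret vector_space coeff_scale by (rule vector_space_coeff_scale)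
  show ?thesis by (rule subspace_diff[OF D_infty_plus_subspace assms])
qed

lemma D_infty_plus_scale:
  assumes "a \<in> D_infty_plus lam" shows "coeff_scale c a \<in> D_infty_plus lam"
proof -
  interpret vector_space coeff_scale by (rule vector_space_coeff_scale)
  show ?thesis by (rule subspace_scale[OF D_infty_plus_subspace assms])
qed

lemma D_infty_plus_add:
  assumes "a \<in> D_infty_plus lam" "b \<in> D_infty_plus lam" shows "a + b \<in> D_infty_plus lam"
proof -
  interpret vector_space coeff_scale by (rule vector_space_coeff_scale)
  show ?thesis by (rule subspace_add[OF D_infty_plus_subspace assms])
qed

lemma zero_in_D_infty_plus: "0 \<in> D_infty_plus lam"
proof -
  interpret vector_space coeff_scale by (rule vector_space_coeff_scale)
  show ?thesis by (rule subspace_0[OF D_infty_plus_subspace])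
qed

lemma dirichlet_limit_diff:
  assumes "a \<in> D_infty_plus lam" "b \<in> D_infty_plus lam" "0 < Re s"
  shows "dirichlet_limit lam (a - b) s = dirichlet_limit lam a s - dirichlet_limit lam b s"
  using dirichlet_limit_add[OF D_infty_plus_diff[OF assms(1,2)] assms(2,3)] by simp

lemma D_infty_plus_norm_0: "D_infty_plus_norm lam k 0 = 0"
proof -
  have "dirichlet_limit lam 0 s = 0" for s by (simp add: dirichlet_limit_def dirichlet_term_def)
  then show ?thesis
    using cSUP_const[OF right_half_plane_nonempty[of "1 / real k"], of "0::real"]
    unfolding D_infty_plus_norm_def by (simp only: norm_zero)
qed

lemma D_infty_plus_norm_diff_triangle:
  assumes "a \<in> D_infty_plus lam" "b \<in> D_infty_plus lam" "c \<in> D_infty_plus lam" "1 \<le> k"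
  shows "D_infty_plus_norm lam k (a - c) \<le> D_infty_plus_norm lam k (a - b) + D_infty_plus_norm lam k (b - c)"
  using D_infty_plus_norm_triangle[OF D_infty_plus_diff[OF assms(1,2)] D_infty_plus_diff[OF assms(2,3)] assms(4)]
  by simp

text \<open>
  The estimate is taken on the line \<open>Re s = 2\<close>, which lies in \<open>[Re > 1/k]\<close> for every
  \<open>k \<ge> 1\<close>.
\<close>

lemma D_infty_plus_coefficient_bound:
  assumes "frequency lam" "a \<in> D_infty_plus lam" "1 \<le> k"
  shows "norm (a m) \<le> D_infty_plus_norm lam k a * exp (lam m * 2)"
proof (rule coefficient_bound[OF assms(1), of _ 1])
  have "1 / real k < 2" using assms(3) by (simp add: divide_less_eq)
  then show "norm (dirichlet_limit lam a s) \<le> D_infty_plus_norm lam k a" if "Re s = 2" for s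
    using that by (intro dirichlet_limit_le_norm[OF assms(2,3)]) (simp del: One_nat_def)
qed (use assms in \<open>auto simp: D_infty_plus_def\<close>)

lemma coeff_shift_in_D_infty_plus:
  assumes "a \<in> D_infty_plus lam" "0 \<le> Re w"
  shows "coeff_shift lam w a \<in> D_infty_plus lam"
proof (rule D_infty_plusI)
  show "dirichlet_converges lam (coeff_shift lam w a) s" if "0 < Re s" for s
    using D_infty_plus_converges[OF assms(1), of "s + w"] that assms(2)
    by (simp add: dirichlet_converges_def dirichlet_term_coeff_shift)
  show "norm (dirichlet_limit lam (coeff_shift lam w a) s) \<le> D_infty_plus_norm lam k a"
    if "1 \<le> k" "1 / real k < Re s" for k s
    unfolding dirichlet_limit_coeff_shift
    by (rule dirichlet_limit_le_norm) (use assms that in auto)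
qed

lemma openin_D_infty_plus_ball:
  assumes "1 \<le> k" "x \<in> D_infty_plus lam" "0 < e"
  shows "openin (D_infty_plus_topology lam) {y \<in> D_infty_plus lam. D_infty_plus_norm lam k (y - x) < e}"
  unfolding D_infty_plus_topology_def seminorm_topology_def
  by (rule topology_generated_by_Basis, rule CollectI, rule exI[of _ k], rule exI[of _ x], rule exI[of _ e])
    (use assms in simp)

text \<open>
  Since the norms increase with \<open>k\<close>, finite intersections of subbasic sets contain single balls.
\<close>

lemma openin_D_infty_plus_topology:
  "openin (D_infty_plus_topology lam) W \<longleftrightarrow> W \<subseteq> D_infty_plus lam \<and>
    (\<forall>x\<in>W. \<exists>k\<ge>1. \<exists>e>0. \<forall>y\<in>D_infty_plus lam. D_infty_plus_norm lam k (y - x) < e \<longrightarrow> y \<in> W)"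
  (is "?open W \<longleftrightarrow> ?P W")
proof
  let ?V = "D_infty_plus lam" and ?n = "D_infty_plus_norm lam"
  let ?S = "{{y \<in> ?V. ?n i (y - x) < e} |i x e. i \<in> {1..} \<and> x \<in> ?V \<and> 0 < e}"
  assume "?open W"
  then have "generate_topology_on ?S W"
    by (simp only: D_infty_plus_topology_def seminorm_topology_def openin_topology_generated_by_iff)
  then show "?P W"
  proof induction
    case (Int A B)
    show ?case
    proof (intro conjI ballI)
      show "A \<inter> B \<subseteq> ?V" using Int.IH by blast
      fix x assume x: "x \<in> A \<inter> B"
      obtain k e where 1: "1 \<le> k" "0 < e" "\<And>y. y \<in> ?V \<Longrightarrow> ?n k (y - x) < e \<Longrightarrow> y \<in> A"
        using Int.IH(1) x by blast
      obtain j d where 2: "1 \<le> j" "0 < d" "\<And>y. y \<in> ?V \<Longrightarrow> ?n j (y - x) < d \<Longrightarrow> y \<in> B"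
        using Int.IH(2) x by blast
      have "x \<in> ?V" using x Int.IH by blast
      then have "y \<in> A \<inter> B" if "y \<in> ?V" "?n (max k j) (y - x) < min e d" for y
        using that 1 2 D_infty_plus_norm_mono[of "y - x" lam k "max k j"]
          D_infty_plus_norm_mono[of "y - x" lam j "max k j"] D_infty_plus_diff by fastforce
      then show "\<exists>k\<ge>1. \<exists>e>0. \<forall>y\<in>?V. ?n k (y - x) < e \<longrightarrow> y \<in> A \<inter> B"
        using 1 2 by (intro exI[of _ "max k j"] conjI exI[of _ "min e d"]) auto
    qed
  next
    case (UN K)
    then show ?case by (meson UnionE UnionI Union_least)
  next
    case (Basis B)
    then obtain i x e where B: "B = {y \<in> ?V. ?n i (y - x) < e}" "1 \<le> i" "x \<in> ?V" by auto
    show ?case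
    proof (intro conjI ballI)
      show "B \<subseteq> ?V" using B by auto
      fix z assume z: "z \<in> B"
      have "y \<in> B" if "y \<in> ?V" "?n i (y - z) < e - ?n i (z - x)" for y
        using D_infty_plus_norm_diff_triangle[of y lam z x i] z that B by auto
      then show "\<exists>k\<ge>1. \<exists>e>0. \<forall>y\<in>?V. ?n k (y - z) < e \<longrightarrow> y \<in> B"
        using z B by (intro exI[of _ i] conjI exI[of _ "e - ?n i (z - x)"]) auto
    qed
  qed auto
next
  let ?V = "D_infty_plus lam" and ?n = "D_infty_plus_norm lam"
  assume W: "?P W"
  show "?open W"
  proof (subst openin_subopen, rule ballI)
    fix x assume x: "x \<in> W"
    then obtain k e where k: "1 \<le> k" "0 < e" "\<And>y. y \<in> ?V \<Longrightarrow> ?n k (y - x) < e \<Longrightarrow> y \<in> W"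
      using W by blast
    let ?B = "{y \<in> ?V. ?n k (y - x) < e}"
    have "openin (D_infty_plus_topology lam) ?B"
      by (rule openin_D_infty_plus_ball) (use k x W in auto)
    moreover have "x \<in> ?B" using x W k by (auto simp: D_infty_plus_norm_0)
    ultimately show "\<exists>T. openin (D_infty_plus_topology lam) T \<and> x \<in> T \<and> T \<subseteq> W"
      using k by blast
  qed
qed

lemma closedin_D_infty_plus_topology:
  "closedin (D_infty_plus_topology lam) A \<longleftrightarrow> A \<subseteq> D_infty_plus lam \<and>
    (\<forall>x\<in>D_infty_plus lam - A. \<exists>k\<ge>1. \<exists>e>0. \<forall>y\<in>D_infty_plus lam. D_infty_plus_norm lam k (y - x) < e \<longrightarrow> y \<notin> A)"
  unfolding closedin_def topspace_D_infty_plus openin_D_infty_plus_topology by blast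

lemma zero_neighbourhood_D_infty_plus:
  "zero_neighbourhood (D_infty_plus_topology lam) U \<longleftrightarrow> U \<subseteq> D_infty_plus lam \<and>
    (\<exists>k\<ge>1. \<exists>e>0. \<forall>y\<in>D_infty_plus lam. D_infty_plus_norm lam k y < e \<longrightarrow> y \<in> U)"
proof
  assume "zero_neighbourhood (D_infty_plus_topology lam) U"
  then obtain W where W: "openin (D_infty_plus_topology lam) W" "0 \<in> W" "W \<subseteq> U"
    and U: "U \<subseteq> D_infty_plus lam"
    by (auto simp: zero_neighbourhood_def topspace_D_infty_plus)
  obtain k e where "1 \<le> k" "0 < e"
    "\<And>y. y \<in> D_infty_plus lam \<Longrightarrow> D_infty_plus_norm lam k (y - 0) < e \<Longrightarrow> y \<in> W"
    using W(1,2) unfolding openin_D_infty_plus_topology by blast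
  then show "U \<subseteq> D_infty_plus lam \<and>
    (\<exists>k\<ge>1. \<exists>e>0. \<forall>y\<in>D_infty_plus lam. D_infty_plus_norm lam k y < e \<longrightarrow> y \<in> U)"
    using U W(3) by (metis diff_zero subsetD)
next
  assume "U \<subseteq> D_infty_plus lam \<and>
    (\<exists>k\<ge>1. \<exists>e>0. \<forall>y\<in>D_infty_plus lam. D_infty_plus_norm lam k y < e \<longrightarrow> y \<in> U)"
  then obtain k e where U: "U \<subseteq> D_infty_plus lam" and k: "1 \<le> k" "0 < e"
    "\<And>y. y \<in> D_infty_plus lam \<Longrightarrow> D_infty_plus_norm lam k y < e \<Longrightarrow> y \<in> U" by blast
  let ?B = "{y \<in> D_infty_plus lam. D_infty_plus_norm lam k (y - 0) < e}"
  have "openin (D_infty_plus_topology lam) ?B"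
    by (rule openin_D_infty_plus_ball[OF k(1) zero_in_D_infty_plus k(2)])
  moreover have "0 \<in> ?B" using k zero_in_D_infty_plus by (auto simp: D_infty_plus_norm_0)
  ultimately show "zero_neighbourhood (D_infty_plus_topology lam) U"
    unfolding zero_neighbourhood_def topspace_D_infty_plus using k U
    by (intro conjI exI[of _ ?B]) auto
qed

lemma bounded_in_D_infty_plus:
  assumes "bounded_in_lcs coeff_scale (D_infty_plus_topology lam) B"
  obtains C where "\<And>a k. a \<in> B \<Longrightarrow> 1 \<le> k \<Longrightarrow> a \<in> D_infty_plus lam \<and> D_infty_plus_norm lam k a \<le> C k"
proof -
  have B: "B \<subseteq> D_infty_plus lam"
    using assms by (simp add: bounded_in_lcs_def topspace_D_infty_plus)
  have "\<exists>C. \<forall>a\<in>B. D_infty_plus_norm lam k a \<le> C" if k: "1 \<le> k" for k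
  proof -
    let ?U = "{y \<in> D_infty_plus lam. D_infty_plus_norm lam k y < 1}"
    have "zero_neighbourhood (D_infty_plus_topology lam) ?U"
      unfolding zero_neighbourhood_D_infty_plus using k
      by (auto intro!: exI[of _ k] exI[of _ "1::real"])
    then obtain r where r: "0 < r" "\<And>c. r \<le> norm c \<Longrightarrow> B \<subseteq> coeff_scale c ` ?U"
      using assms by (auto simp: bounded_in_lcs_def absorbs_def)
    have "D_infty_plus_norm lam k a \<le> r" if aB: "a \<in> B" for a
    proof -
      have "B \<subseteq> coeff_scale (of_real r) ` ?U" using r by simp
      then obtain u where u: "u \<in> ?U" "a = coeff_scale (of_real r) u" using aB by blast
      then show ?thesis
        using D_infty_plus_norm_scale[of u lam k "of_real r"] k r(1) mult_left_mono[of "D_infty_plus_norm lam k u" 1 r]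
        by simp
    qed
    then show ?thesis by blast
  qed
  then obtain C where "\<And>k a. 1 \<le> k \<Longrightarrow> a \<in> B \<Longrightarrow> D_infty_plus_norm lam k a \<le> C k" by metis
  then show thesis using B by (intro that) auto
qed

section \<open>Barrelledness implies the Bohr theorem\<close>

lemma partial_sum_add:
  "partial_sum lam (a + b) s N = partial_sum lam a s N + partial_sum lam b s N"
  by (simp only: dirichlet_term_add sum.distrib)

lemma partial_sum_scale:
  "partial_sum lam (coeff_scale c a) s N = c * partial_sum lam a s N"
  by (simp only: dirichlet_term_scale sum_distrib_left)

lemma partial_sum_diff:
  "partial_sum lam (a - b) s N = partial_sum lam a s N - partial_sum lam b s N"
  by (simp only: dirichlet_term_diff sum_subtractf)

lemma partial_sum_norm_le:
  assumes "frequency lam" "0 \<le> Re s"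
  shows "norm (partial_sum lam a s N) \<le> (\<Sum>n<N. norm (a n))"
proof (rule order_trans[OF norm_sum], rule sum_mono)
  fix n
  have "exp (- (lam n * Re s)) \<le> 1" using frequency_nonneg[OF assms(1), of n] assms(2) by simp
  then show "norm (dirichlet_term lam a s n) \<le> norm (a n)"
    using mult_left_mono[of "exp (- (lam n * Re s))" 1 "norm (a n)"]
    by (simp add: dirichlet_term_def norm_mult)
qed

lemma sigma_c_le:
  assumes "frequency lam" "dirichlet_converges lam a s0"
  shows "sigma_c lam a \<le> ereal (Re s0)"
  unfolding sigma_c_def
  by (rule Inf_lower) (use dirichlet_converges_mono[OF assms] in auto)

lemma sigma_u_nonposI:
  assumes "\<And>\<delta>. 0 < \<delta> \<Longrightarrow> uniformly_convergent_on (right_half_plane \<delta>) (\<lambda>N s. partial_sum lam a s N)"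
  shows "sigma_u lam a \<le> 0"
proof (rule ereal_le_epsilon2)
  show "sigma_u lam a \<le> 0 + ereal e" if "0 < e" for e
    unfolding sigma_u_def using assms[OF that] by (auto intro!: Inf_lower)
qed

text \<open>
  The series whose partial sums at \<open>s\<close> all lie in the unit disc form a barrel: absorbing because every
  series of the space converges at \<open>s\<close>, closed because the coefficients depend continuously on the series.
  A ball contained in the barrel yields the constants.
\<close>

lemma barrelled_partial_sum_bound:
  assumes freq: "frequency lam" and bar: "barrelled_space coeff_scale (D_infty_plus_topology lam)"
    and s: "0 < Re s"
  obtains C k where "1 \<le> k" "0 \<le> C" "\<And>a N. a \<in> D_infty_plus lam \<Longrightarrow>
      norm (partial_sum lam a s N) \<le> C * D_infty_plus_norm lam k a"
proof -
  define A where "A = {a \<in> D_infty_plus lam. \<forall>N. norm (partial_sum lam a s N) \<le> 1}"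
  have "absolutely_convex coeff_scale A"
    unfolding absolutely_convex_def
  proof (intro ballI allI impI)
    fix x y c d assume x: "x \<in> A" and y: "y \<in> A" and cd: "norm (c::complex) + norm (d::complex) \<le> 1"
    have "norm (partial_sum lam (coeff_scale c x + coeff_scale d y) s N) \<le> 1" for N
    proof -
      have "norm (partial_sum lam (coeff_scale c x + coeff_scale d y) s N)
        \<le> norm c * norm (partial_sum lam x s N) + norm d * norm (partial_sum lam y s N)"
        unfolding partial_sum_add partial_sum_scale norm_mult[symmetric] by (rule norm_triangle_ineq)
      also have "\<dots> \<le> norm c * 1 + norm d * 1"
        by (intro add_mono mult_left_mono) (use x y in \<open>auto simp: A_def\<close>)
      finally show ?thesis using cd by simp
    qed
    then show "coeff_scale c x + coeff_scale d y \<in> A"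
      using x y by (auto simp: A_def intro!: D_infty_plus_add D_infty_plus_scale)
  qed
  moreover have "closedin (D_infty_plus_topology lam) A"
    unfolding closedin_D_infty_plus_topology
  proof (intro conjI ballI)
    show "A \<subseteq> D_infty_plus lam" by (auto simp: A_def)
    fix x assume "x \<in> D_infty_plus lam - A"
    then obtain N where x: "x \<in> D_infty_plus lam" and N: "1 < norm (partial_sum lam x s N)"
      by (auto simp: A_def not_le)
    define c where "c = (\<Sum>n<N. exp (lam n * 2))"
    have c: "0 \<le> c" by (simp add: c_def sum_nonneg)
    define e where "e = (norm (partial_sum lam x s N) - 1) / (c + 1)"
    have e: "0 < e" using N c by (simp add: e_def)
    have "y \<notin> A" if y: "y \<in> D_infty_plus lam" and ye: "D_infty_plus_norm lam 1 (y - x) < e" for y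
    proof -
      have "norm (partial_sum lam (y - x) s N) \<le> (\<Sum>n<N. norm ((y - x) n))"
        by (rule partial_sum_norm_le[OF freq]) (use s in simp)
      also have "\<dots> \<le> (\<Sum>n<N. D_infty_plus_norm lam 1 (y - x) * exp (lam n * 2))"
        by (intro sum_mono D_infty_plus_coefficient_bound[OF freq] D_infty_plus_diff x y) simp
      also have "\<dots> = D_infty_plus_norm lam 1 (y - x) * c"
        by (simp only: c_def sum_distrib_left)
      also have "\<dots> \<le> e * c" using ye c by (intro mult_right_mono) auto
      also have "\<dots> < e * (c + 1)" using e by simp
      also have "\<dots> = norm (partial_sum lam x s N) - 1" using c by (simp add: e_def)
      finally have "1 < norm (partial_sum lam x s N) - norm (partial_sum lam (y - x) s N)" by simp
      also have "\<dots> \<le> norm (partial_sum lam y s N)"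
        unfolding partial_sum_diff
        using norm_triangle_ineq2[of "partial_sum lam x s N" "partial_sum lam x s N - partial_sum lam y s N"]
        by (simp add: norm_minus_commute)
      finally show ?thesis by (auto simp: A_def not_le)
    qed
    then show "\<exists>k\<ge>1. \<exists>e>0. \<forall>y\<in>D_infty_plus lam. D_infty_plus_norm lam k (y - x) < e \<longrightarrow> y \<notin> A"
      using e by blast
  qed
  moreover have "absorbing coeff_scale (D_infty_plus_topology lam) A"
    unfolding absorbing_def topspace_D_infty_plus absorbs_def
  proof
    fix x assume x: "x \<in> D_infty_plus lam"
    obtain K where K: "\<And>N. norm (partial_sum lam x s N) \<le> K"
      using dirichlet_converges_imp_bounded_partial_sums[OF D_infty_plus_converges[OF x s]] by blast
    have "{x} \<subseteq> coeff_scale c ` A" if c: "max K 1 \<le> norm c" for c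
    proof -
      have c0: "c \<noteq> 0" using c by auto
      have "coeff_scale (inverse c) x \<in> A"
        unfolding A_def
      proof (safe intro!: D_infty_plus_scale x)
        fix N
        have "norm (partial_sum lam x s N) \<le> norm c" using K[of N] c by simp
        moreover have "norm (partial_sum lam (coeff_scale (inverse c) x) s N) = norm (partial_sum lam x s N) / norm c"
          unfolding partial_sum_scale by (simp add: norm_mult norm_inverse divide_inverse mult.commute)
        ultimately show "norm (partial_sum lam (coeff_scale (inverse c) x) s N) \<le> 1"
          using c0 by (simp add: divide_le_eq)
      qed
      moreover have "x = coeff_scale c (coeff_scale (inverse c) x)"
        using c0 by (simp add: coeff_scale_def mult.assoc[symmetric])
      ultimately show ?thesis by blast
    qed
    then show "\<exists>r>0. \<forall>c. r \<le> norm c \<longrightarrow> {x} \<subseteq> coeff_scale c ` A"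
      by (intro exI[of _ "max K 1"]) auto
  qed
  ultimately have "zero_neighbourhood (D_infty_plus_topology lam) A"
    using bar by (auto simp: barrelled_space_def barrel_def)
  then obtain k e where k: "1 \<le> k" and e: "0 < e"
    and ke: "\<And>y. y \<in> D_infty_plus lam \<Longrightarrow> D_infty_plus_norm lam k y < e \<Longrightarrow> y \<in> A"
    unfolding zero_neighbourhood_D_infty_plus by blast
  have "norm (partial_sum lam a s N) \<le> 1 / e * D_infty_plus_norm lam k a"
    if a: "a \<in> D_infty_plus lam" for a N
  proof -
    have "norm (partial_sum lam a s N) * e \<le> t" if t: "D_infty_plus_norm lam k a < t" for t
    proof -
      have t0: "0 < t" using t D_infty_plus_norm_nonneg[OF a k] by linarith
      let ?y = "coeff_scale (of_real (e / t)) a"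
      have "D_infty_plus_norm lam k ?y = e / t * D_infty_plus_norm lam k a"
        using D_infty_plus_norm_scale[OF a k, of "of_real (e / t)"] e t0 by (simp add: norm_divide)
      also have "\<dots> < e" using t t0 e by (simp add: field_simps)
      finally have "?y \<in> A" by (intro ke D_infty_plus_scale a)
      then have "norm (partial_sum lam ?y s N) \<le> 1" by (simp add: A_def)
      then show ?thesis
        unfolding partial_sum_scale using e t0 by (simp add: norm_mult norm_divide field_simps)
    qed
    then have "norm (partial_sum lam a s N) * e \<le> D_infty_plus_norm lam k a" by (rule dense_ge)
    then show ?thesis using e by (simp add: field_simps)
  qed
  then show thesis using k e by (intro that[of k "1 / e"]) auto
qed

text \<open>
  The smoothed series lie in the space with norms at most \<open>sup |f|\<close>, independently of \<open>R\<close>.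
  The bound at the single point \<open>\<sigma>\<close> is moved to an arbitrary \<open>s\<close> with \<open>Re s
  \<ge> \<sigma>\<close> by translating the series, which does not increase the norms.
\<close>

theorem barrelled_imp_bohr:
  assumes freq: "frequency lam" and bar: "barrelled_space coeff_scale (D_infty_plus_topology lam)"
  shows "bohr_theorem_holds lam"
  unfolding bohr_theorem_holds_def
proof
  fix a assume "a \<in> D_infty_ext lam"
  then obtain s0 f where c: "dirichlet_converges lam a s0"
    and holf: "f holomorphic_on right_half_plane 0"
    and bd: "bounded (f ` right_half_plane 0)"
    and eq: "\<And>s. 0 < Re s \<Longrightarrow> sigma_c lam a < ereal (Re s) \<Longrightarrow> f s = dirichlet_limit lam a s"
    by (auto simp: D_infty_ext_def)
  obtain M where M: "\<And>s. 0 < Re s \<Longrightarrow> norm (f s) \<le> M"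
    using bd by (auto simp: bounded_iff)
  have "0 \<le> M" using order_trans[OF norm_ge_zero M[of 1]] by simp
  have eq': "f s = dirichlet_limit lam a s" if "0 < Re s" "Re s0 < Re s" for s
    using eq[OF that(1)] le_less_trans[OF sigma_c_le[OF freq c], of "ereal (Re s)"] that by simp
  have smooth_bound: "norm (dirichlet_limit lam (gauss_smooth lam R a) s) \<le> M" if "0 < R" "0 < Re s" for R s
    by (rule gauss_smooth_limit_bound[OF freq c that(1) holf M eq' that(2)])
  have smooth: "gauss_smooth lam R a \<in> D_infty_plus lam" if R: "0 < R" for R
  proof (rule D_infty_plusI)
    show "norm (dirichlet_limit lam (gauss_smooth lam R a) s) \<le> M" if "1 / real k < Re s" for k s
      using smooth_bound[OF R, of s] that order_le_less_trans[of 0 "1 / real k" "Re s"] by simp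
  qed (rule gauss_smooth_converges[OF freq c R])
  show "sigma_u lam a \<le> 0"
  proof (rule sigma_u_nonposI)
    fix \<delta> :: real assume \<delta>: "0 < \<delta>"
    define \<sigma> where "\<sigma> = \<delta> / 2"
    have \<sigma>: "0 < \<sigma>" using \<delta> by (simp add: \<sigma>_def)
    obtain C k where k: "1 \<le> k" and C: "0 \<le> C" "\<And>a N. a \<in> D_infty_plus lam \<Longrightarrow>
        norm (partial_sum lam a (of_real \<sigma>) N) \<le> C * D_infty_plus_norm lam k a"
      by (rule barrelled_partial_sum_bound[OF freq bar, of "of_real \<sigma>"]) (use \<sigma> in \<open>auto simp del: One_nat_def\<close>)
    have smooth_partial: "norm (partial_sum lam (gauss_smooth lam R a) s N) \<le> C * M"
      if R: "0 < R" and s: "\<sigma> \<le> Re s" for R s N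
    proof -
      let ?b = "coeff_shift lam (s - of_real \<sigma>) (gauss_smooth lam R a)"
      have b: "?b \<in> D_infty_plus lam"
        by (rule coeff_shift_in_D_infty_plus[OF smooth[OF R]]) (use s in simp)
      have "D_infty_plus_norm lam k ?b \<le> M"
      proof (rule D_infty_plus_norm_le)
        fix z assume "1 / real k < Re z"
        moreover have "0 \<le> 1 / real k" by simp
        ultimately have "0 < Re z" by linarith
        then show "norm (dirichlet_limit lam ?b z) \<le> M"
          unfolding dirichlet_limit_coeff_shift by (intro smooth_bound R) (use s in simp)
      qed
      then have "C * D_infty_plus_norm lam k ?b \<le> C * M" using C(1) by (rule mult_left_mono)
      then have "norm (partial_sum lam ?b (of_real \<sigma>) N) \<le> C * M"
        using C(2)[OF b, of N] by linarith
      then show ?thesis by (simp add: dirichlet_term_coeff_shift)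
    qed
    have "norm (partial_sum lam a s N) \<le> C * M" if s: "\<sigma> \<le> Re s" for s N
    proof -
      \<comment> \<open>A fixed partial sum has finitely many terms, so the smoothing can be removed by \<open>R \<rightarrow> 0\<close>.\<close>
      have "(\<lambda>j. gauss_weight (1 / real (Suc j)) (lam n)) \<longlonglongrightarrow> gauss_weight 0 (lam n)" for n
        unfolding gauss_weight_def
        by (intro tendsto_intros LIMSEQ_Suc[OF lim_1_over_n]) simp
      then have "(\<lambda>j. partial_sum lam (gauss_smooth lam (1 / real (Suc j)) a) s N)
          \<longlonglongrightarrow> (\<Sum>n<N. a n * of_real (gauss_weight 0 (lam n)) * exp (- (of_real (lam n) * s)))"
        unfolding dirichlet_term_def gauss_smooth_def by (intro tendsto_intros)
      then have "(\<lambda>j. partial_sum lam (gauss_smooth lam (1 / real (Suc j)) a) s N) \<longlonglongrightarrow> partial_sum lam a s N"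
        by (simp add: gauss_weight_def dirichlet_term_def)
      then show ?thesis
        by (rule Lim_norm_ubound[OF sequentially_bot]) (use smooth_partial[OF _ s] in simp)
    qed
    then have "uniform_limit (right_half_plane (\<sigma> + \<sigma>)) (\<lambda>N s. partial_sum lam a s N)
        (dirichlet_limit lam a) sequentially"
      by (rule half_plane_uniform_limit[OF freq _ \<sigma>])
    then show "uniformly_convergent_on (right_half_plane \<delta>) (\<lambda>N s. partial_sum lam a s N)"
      unfolding \<sigma>_def by (auto intro: uniformly_convergentI)
  qed
qed

section \<open>A quantitative form of the Bohr theorem\<close>

lemma sigma_c_lessD:
  assumes "sigma_c lam a < ereal (Re s)"
  shows "dirichlet_converges lam a s"
  using assms unfolding sigma_c_def by (auto simp: Inf_less_iff)

lemma sigma_u_nonposD: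
  assumes "sigma_u lam a \<le> 0" "0 < \<delta>"
  shows "uniformly_convergent_on (right_half_plane \<delta>) (\<lambda>N s. partial_sum lam a s N)"
proof -
  have "sigma_u lam a < ereal \<delta>" using assms le_less_trans[of "sigma_u lam a" 0 "ereal \<delta>"] by simp
  then obtain \<sigma> where "\<sigma> < \<delta>"
    "uniformly_convergent_on (right_half_plane \<sigma>) (\<lambda>N s. partial_sum lam a s N)"
    unfolding sigma_u_def by (auto simp: Inf_less_iff)
  then show ?thesis by (auto elim!: uniformly_convergent_on_subset)
qed

lemma polynomial_coefficient_bound:
  assumes freq: "frequency lam" and M: "\<And>s. 0 < Re s \<Longrightarrow> norm (partial_sum lam a s E) \<le> M"
    and m: "m < E"
  shows "norm (a m) \<le> M * exp (lam m)"
proof -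
  define b where "b n = (if n < E then a n else 0)" for n
  have fin: "dirichlet_term lam b s n = 0" if "n \<notin> {..<E}" for s n
    using that by (simp add: b_def dirichlet_term_def)
  have conv: "dirichlet_converges lam b s" for s
    unfolding dirichlet_converges_def by (rule summable_finite[of "{..<E}"]) (use fin in auto)
  have "dirichlet_limit lam b s = partial_sum lam a s E" for s
    unfolding dirichlet_limit_def
    by (subst suminf_finite[of "{..<E}"]) (use fin in \<open>auto simp: b_def dirichlet_term_def\<close>)
  then have "norm (b m) \<le> M * exp (lam m * 1)"
    by (intro coefficient_bound[OF freq conv[of 0]]) (auto intro!: M)
  then show ?thesis using m by (simp add: b_def)
qed

text \<open>
  The building block of the gliding hump. The bound 1 on the partial sums at \<open>\<sigma>\<close> keeps a sum of
  such blocks convergent to the right of \<open>\<sigma>\<close>; that the value 1 is attained prevents convergence at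
  \<open>\<sigma>\<close> itself.
\<close>

definition hump :: "(nat \<Rightarrow> real) \<Rightarrow> real \<Rightarrow> nat \<Rightarrow> nat \<Rightarrow> real \<Rightarrow> (nat \<Rightarrow> complex) \<Rightarrow> bool" where
  "hump lam \<sigma> m E e Q \<longleftrightarrow> m < E \<and> (\<forall>n. n \<notin> {m..<E} \<longrightarrow> Q n = 0)
    \<and> (\<forall>s. 0 < Re s \<longrightarrow> norm (partial_sum lam Q s E) \<le> e)
    \<and> (\<forall>N. norm (partial_sum lam Q (of_real \<sigma>) N) \<le> 1)
    \<and> (\<exists>N\<in>{m..E}. norm (partial_sum lam Q (of_real \<sigma>) N) = 1)"

text \<open>
  Removing the terms with index below \<open>m\<close> changes a polynomial bounded by \<open>M\<close> on \<open>[Re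
  > 0]\<close>, and its partial sums, by at most \<open>c M\<close> where \<open>c\<close> depends on \<open>m\<close>
  alone, because the coefficients are bounded. Hence the remaining polynomial still has a partial sum at
  \<open>\<sigma>\<close> that is large compared with its supremum, and dividing by the largest partial sum
  \<open>H\<close> normalises it.
\<close>

lemma hump_exists:
  assumes freq: "frequency lam" and \<sigma>: "0 < \<sigma>" and e: "0 < e"
    and unbounded: "\<And>C. \<exists>a E M N. (\<forall>s. 0 < Re s \<longrightarrow> norm (partial_sum lam a s E) \<le> M)
      \<and> N \<le> E \<and> C * M < norm (partial_sum lam a (of_real \<sigma>) N)"
  shows "\<exists>E Q. hump lam \<sigma> m E e Q"
proof -
  define c where "c = (\<Sum>n<m. exp (lam n))"
  have c: "0 \<le> c" by (simp add: c_def sum_nonneg)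
  \<comment> \<open>The constant is chosen so that \<open>H\<close> exceeds \<open>(1 + c) M / e\<close>, while the truncated
    polynomial is bounded by \<open>(1 + c) M\<close>.\<close>
  obtain a E M N where M: "\<And>s. 0 < Re s \<Longrightarrow> norm (partial_sum lam a s E) \<le> M"
    and N: "N \<le> E" and big: "(c + (1 + c) / e) * M < norm (partial_sum lam a (of_real \<sigma>) N)"
    using unbounded[of "c + (1 + c) / e"] by blast
  have M0: "0 \<le> M" using order_trans[OF norm_ge_zero M[of 1]] by simp
  have head: "norm (partial_sum lam a s j) \<le> c * M" if "0 \<le> Re s" "j \<le> m" "j \<le> E" for s j
  proof -
    have "norm (partial_sum lam a s j) \<le> (\<Sum>n<j. norm (a n))"
      by (rule partial_sum_norm_le[OF freq that(1)])
    also have "\<dots> \<le> (\<Sum>n<j. M * exp (lam n))"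
      by (intro sum_mono polynomial_coefficient_bound[OF freq M]) (use that in auto)
    also have "\<dots> \<le> (\<Sum>n<m. M * exp (lam n))"
      by (rule sum_mono2) (use that M0 in auto)
    also have "\<dots> = c * M" by (simp add: c_def sum_distrib_left mult.commute)
    finally show ?thesis .
  qed
  have cM: "c * M \<le> (c + (1 + c) / e) * M"
    using c e M0 by (intro mult_right_mono) auto
  have mN: "m < N"
  proof (rule ccontr)
    assume "\<not> m < N"
    then have "norm (partial_sum lam a (of_real \<sigma>) N) \<le> c * M"
      using \<sigma> N by (intro head) auto
    then show False using big cM by linarith
  qed
  then have mE: "m < E" using N by simp
  define Q0 where "Q0 n = (if n \<in> {m..<E} then a n else 0)" for n
  have Q0: "partial_sum lam Q0 s j = partial_sum lam a s (min j E) - partial_sum lam a s (min j m)" for s j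
  proof (induction j)
    case (Suc j)
    consider "j < m" | "m \<le> j" "j < E" | "E \<le> j" by linarith
    then show ?case
    proof cases
      case 1 then show ?thesis using Suc mE by (simp add: Q0_def dirichlet_term_def min_def)
    next
      case 2 then show ?thesis using Suc by (simp add: Q0_def dirichlet_term_def min_def)
    next
      case 3 then show ?thesis using Suc mE by (simp add: Q0_def dirichlet_term_def min_def)
    qed
  qed simp
  define A where "A j = norm (partial_sum lam Q0 (of_real \<sigma>) j)" for j
  define H where "H = Max (A ` {..E})"
  have A_le: "A j \<le> H" for j
  proof -
    have "A (min j E) \<le> H" unfolding H_def by (rule Max_ge) auto
    moreover have "A (min j E) = A j" using mE by (simp add: A_def Q0 min.assoc min_absorb2)
    ultimately show ?thesis by simp
  qed
  have "(1 + c) / e * M < A N"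
  proof -
    have "norm (partial_sum lam a (of_real \<sigma>) N) \<le> A N + norm (partial_sum lam a (of_real \<sigma>) m)"
      unfolding A_def Q0
      using N mN norm_triangle_sub[of "partial_sum lam a (of_real \<sigma>) N" "partial_sum lam a (of_real \<sigma>) m"]
      by (simp add: min_absorb1 min_absorb2)
    moreover have "norm (partial_sum lam a (of_real \<sigma>) m) \<le> c * M"
      using \<sigma> mE by (intro head) auto
    ultimately show ?thesis using big by (simp add: algebra_simps)
  qed
  then have H: "(1 + c) / e * M < H" using A_le[of N] by linarith
  moreover have "0 \<le> (1 + c) / e * M" using c e M0 by simp
  ultimately have H0: "0 < H" by linarith
  have "H \<in> A ` {..E}" unfolding H_def by (rule Max_in) auto
  then obtain j where j: "j \<le> E" "A j = H" by auto
  have "m \<le> j"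
  proof (rule ccontr)
    assume "\<not> m \<le> j"
    then have "A j = 0" using j(1) by (simp add: A_def Q0 min_absorb1)
    then show False using j H0 by simp
  qed
  define Q where "Q = coeff_scale (of_real (1 / H)) Q0"
  have Q: "norm (partial_sum lam Q s i) = norm (partial_sum lam Q0 s i) / H" for s i
    unfolding Q_def partial_sum_scale using H0 by (simp add: norm_mult norm_divide)
  have "hump lam \<sigma> m E e Q"
    unfolding hump_def
  proof (intro conjI allI impI)
    show "Q n = 0" if "n \<notin> {m..<E}" for n using that by (auto simp: Q_def Q0_def coeff_scale_def)
    show "norm (partial_sum lam Q s E) \<le> e" if s: "0 < Re s" for s
    proof -
      have "norm (partial_sum lam Q0 s E) \<le> norm (partial_sum lam a s E) + norm (partial_sum lam a s m)"
        unfolding Q0 using mE norm_triangle_ineq4 by (simp add: min_absorb2)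
      also have "\<dots> \<le> M + c * M" by (intro add_mono M head) (use s mE in auto)
      also have "\<dots> \<le> e * H" using H e by (simp add: field_simps)
      finally show ?thesis unfolding Q using H0 by (simp add: divide_le_eq)
    qed
    show "norm (partial_sum lam Q (of_real \<sigma>) i) \<le> 1" for i
      using A_le[of i] H0 unfolding Q A_def by (simp add: divide_le_eq)
    show "\<exists>N\<in>{m..E}. norm (partial_sum lam Q (of_real \<sigma>) N) = 1"
      using j \<open>m \<le> j\<close> H0 unfolding Q A_def by (intro bexI[of _ j]) auto
  qed (rule mE)
  then show ?thesis by blast
qed

text \<open>
  The sums of complete blocks converge uniformly on \<open>[Re > 0]\<close> by the Weierstrass test, and their limit is
  the bounded extension. Between block ends the partial sums at \<open>\<sigma>\<close> differ from these by at most 1, so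
  they are bounded and the series converges to the right of \<open>\<sigma>\<close>.
\<close>

lemma hump_series_in_D_infty_ext:
  assumes freq: "frequency lam" and \<sigma>: "0 < \<sigma>" and mm: "strict_mono mm" "mm 0 = 0"
    and q: "\<And>j. hump lam \<sigma> (mm j) (mm (Suc j)) ((1/2) ^ j) (q j)"
    and d: "\<And>j n. mm j \<le> n \<Longrightarrow> n < mm (Suc j) \<Longrightarrow> d n = q j n"
  shows "d \<in> D_infty_ext lam"
    and "\<And>J N s. mm J \<le> N \<Longrightarrow> N \<le> mm (Suc J) \<Longrightarrow>
      partial_sum lam d s N = partial_sum lam d s (mm J) + partial_sum lam (q J) s N"
proof -
  have supp: "q j n = 0" if "n \<notin> {mm j..<mm (Suc j)}" for j n
    using q[of j] that by (auto simp: hump_def)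
  have le: "mm j \<le> mm (Suc j)" for j using mm(1) by (simp add: strict_mono_less_eq)
  show block: "partial_sum lam d s N = partial_sum lam d s (mm J) + partial_sum lam (q J) s N"
    if "mm J \<le> N" "N \<le> mm (Suc J)" for J N s
    using that
  proof (induction N rule: dec_induct)
    case base
    have "partial_sum lam (q J) s (mm J) = 0"
      by (rule sum.neutral) (auto simp: dirichlet_term_def supp)
    then show ?case by simp
  next
    case (step N)
    then show ?case using d[of J N] by (simp add: dirichlet_term_def)
  qed
  define P where "P j s = partial_sum lam (q j) s (mm (Suc j))" for j s
  have P_le: "norm (P j s) \<le> (1/2) ^ j" if "0 < Re s" for j s
    using q[of j] that by (auto simp: hump_def P_def)
  have blocks: "partial_sum lam d s (mm J) = (\<Sum>j<J. P j s)" for J s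
    by (induction J) (use mm(2) block[of J "mm (Suc J)" s for J] le in \<open>auto simp: P_def\<close>)
  have geo: "summable (\<lambda>j. (1/2::real) ^ j)" by (rule summable_geometric) simp
  define f where "f s = (\<Sum>j. P j s)" for s
  have ul: "uniform_limit (right_half_plane 0) (\<lambda>J s. \<Sum>j<J. P j s) f sequentially"
    unfolding f_def by (rule Weierstrass_m_test[OF _ geo]) (use P_le in auto)
  have op: "open (right_half_plane 0)" by (rule open_halfspace_Re_gt)
  have holf: "f holomorphic_on right_half_plane 0"
  proof (rule holomorphic_uniform_sequence[OF op])
    show "(\<lambda>s. \<Sum>j<J. P j s) holomorphic_on right_half_plane 0" for J
      unfolding P_def by (intro holomorphic_on_sum dirichlet_term_holomorphic)
    fix x assume "x \<in> right_half_plane 0"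
    then obtain r where "0 < r" "cball x r \<subseteq> right_half_plane 0"
      using op open_contains_cball by blast
    then show "\<exists>r>0. cball x r \<subseteq> right_half_plane 0 \<and>
        uniform_limit (cball x r) (\<lambda>J s. \<Sum>j<J. P j s) f sequentially"
      using uniform_limit_on_subset[OF ul] by blast
  qed
  have "norm (f s) \<le> (\<Sum>j. (1/2) ^ j)" if "0 < Re s" for s
    unfolding f_def by (rule norm_suminf_le[OF P_le[OF that] geo])
  then have bd: "bounded (f ` right_half_plane 0)" by (auto simp: bounded_iff)
  show "d \<in> D_infty_ext lam"
    unfolding D_infty_ext_def
  proof (intro CollectI conjI exI[of _ f] exI[of _ "of_real \<sigma> + 1"] holf bd ballI impI)
    have "norm (partial_sum lam d (of_real \<sigma>) N) \<le> (\<Sum>j. (1/2) ^ j) + 1" for N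
    proof -
      have "\<exists>J. mm J \<le> N \<and> N \<le> mm (Suc J)"
      proof (induction N)
        case (Suc N)
        then obtain J where J: "mm J \<le> N" "N \<le> mm (Suc J)" by blast
        show ?case
        proof (cases "N = mm (Suc J)")
          case True
          then show ?thesis using mm(1) by (intro exI[of _ "Suc J"]) (simp add: Suc_leI strict_mono_less)
        next
          case False
          then show ?thesis using J by (intro exI[of _ J]) auto
        qed
      qed (use mm(2) in \<open>auto intro!: exI[of _ 0]\<close>)
      then obtain J where J: "mm J \<le> N" "N \<le> mm (Suc J)" by blast
      have "norm (\<Sum>j<J. P j (of_real \<sigma>)) \<le> (\<Sum>j<J. (1/2) ^ j)"
        by (rule order_trans[OF norm_sum]) (use P_le \<sigma> in \<open>auto intro!: sum_mono\<close>)
      also have "\<dots> \<le> (\<Sum>j. (1/2) ^ j)"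
        by (rule sum_le_suminf[OF geo]) auto
      finally have 1: "norm (\<Sum>j<J. P j (of_real \<sigma>)) \<le> (\<Sum>j. (1/2) ^ j)" .
      have "norm (partial_sum lam (q J) (of_real \<sigma>) N) \<le> 1" using q[of J] by (simp add: hump_def)
      then show ?thesis
        unfolding block[OF J] blocks using 1 by (intro norm_triangle_le add_mono)
    qed
    then show "dirichlet_converges lam d (of_real \<sigma> + 1)"
      by (rule bounded_partial_sums_converges[OF freq]) simp
  next
    fix s assume s: "s \<in> right_half_plane 0" "sigma_c lam d < ereal (Re s)"
    have "(\<lambda>J. partial_sum lam d s (mm J)) \<longlonglongrightarrow> dirichlet_limit lam d s"
      using LIMSEQ_subseq_LIMSEQ[OF partial_sum_tendsto[OF sigma_c_lessD[OF s(2)]] mm(1)]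
      by (simp add: comp_def)
    moreover have "(\<lambda>J. partial_sum lam d s (mm J)) \<longlonglongrightarrow> f s"
      unfolding blocks by (rule tendsto_uniform_limitI[OF ul s(1)])
    ultimately show "f s = dirichlet_limit lam d s" using LIMSEQ_unique by blast
  qed
qed

text \<open>
  If the bound fails, humps with suprema \<open>2\<^sup>-\<^sup>j\<close> can be placed one after another. The Bohr
  theorem makes the glued series converge at \<open>\<sigma>\<close>, but inside each block its partial sums there
  move by 1.
\<close>

lemma bohr_polynomial_bound:
  assumes freq: "frequency lam" and bohr: "bohr_theorem_holds lam" and \<sigma>: "0 < \<sigma>"
  obtains C where "0 \<le> C" "\<And>a E M N. (\<And>s. 0 < Re s \<Longrightarrow> norm (partial_sum lam a s E) \<le> M) \<Longrightarrow> N \<le> E \<Longrightarrow>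
    norm (partial_sum lam a (of_real \<sigma>) N) \<le> C * M"
proof -
  have "\<exists>C. \<forall>a E M N. (\<forall>s. 0 < Re s \<longrightarrow> norm (partial_sum lam a s E) \<le> M) \<and> N \<le> E \<longrightarrow>
      norm (partial_sum lam a (of_real \<sigma>) N) \<le> C * M"
  proof (rule ccontr)
    assume "\<not> ?thesis"
    then have unbounded: "\<exists>a E M N. (\<forall>s. 0 < Re s \<longrightarrow> norm (partial_sum lam a s E) \<le> M)
        \<and> N \<le> E \<and> C * M < norm (partial_sum lam a (of_real \<sigma>) N)" for C
      by (simp add: not_le)
    have "\<forall>m j. \<exists>E Q. hump lam \<sigma> m E ((1/2) ^ j) Q"
      using hump_exists[OF freq \<sigma> _ unbounded] by simp
    then obtain E Q where EQ: "\<And>m j. hump lam \<sigma> m (E m j) ((1/2) ^ j) (Q m j)" by metis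
    define mm where "mm = rec_nat 0 (\<lambda>j m. E m j)"
    have mm0: "mm 0 = 0" and mmS: "mm (Suc j) = E (mm j) j" for j by (auto simp: mm_def)
    define q where "q j = Q (mm j) j" for j
    have q: "hump lam \<sigma> (mm j) (mm (Suc j)) ((1/2) ^ j) (q j)" for j
      unfolding mmS q_def by (rule EQ)
    have mono: "strict_mono mm"
      unfolding strict_mono_Suc_iff using q by (auto simp: hump_def)
    have j_le: "j \<le> mm j" for j by (rule strict_mono_imp_increasing[OF mono])
    \<comment> \<open>At most one block contributes to each coefficient; it has index at most \<open>n\<close> because \<open>j \<le> mm j\<close>.\<close>
    define d where "d n = (\<Sum>j\<le>n. q j n)" for n
    have d: "d n = q j n" if "mm j \<le> n" "n < mm (Suc j)" for j n
    proof -
      have "q i n = (if i = j then q j n else 0)" for i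
      proof (cases i j rule: linorder_cases)
        case less
        then have "mm (Suc i) \<le> mm j" using mono by (simp add: strict_mono_less_eq)
        then show ?thesis using less that q[of i] by (auto simp: hump_def)
      next
        case greater
        then have "mm (Suc j) \<le> mm i" using mono by (simp add: strict_mono_less_eq)
        then show ?thesis using greater that q[of i] by (auto simp: hump_def)
      qed simp
      then have "d n = (\<Sum>i\<le>n. if i = j then q j n else 0)" unfolding d_def by (rule sum.cong[OF refl])
      also have "\<dots> = q j n" using order_trans[OF j_le that(1)] by simp
      finally show ?thesis .
    qed
    have ext: "d \<in> D_infty_ext lam"
      and block: "\<And>J N s. mm J \<le> N \<Longrightarrow> N \<le> mm (Suc J) \<Longrightarrow>
        partial_sum lam d s N = partial_sum lam d s (mm J) + partial_sum lam (q J) s N"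
      using hump_series_in_D_infty_ext[OF freq \<sigma> mono mm0 q d] by blast+
    have "sigma_u lam d \<le> 0" using bohr ext by (simp add: bohr_theorem_holds_def)
    then have "uniformly_convergent_on (right_half_plane (\<sigma> / 2)) (\<lambda>N s. partial_sum lam d s N)"
      using \<sigma> by (intro sigma_u_nonposD) auto
    then obtain l where "uniform_limit (right_half_plane (\<sigma> / 2)) (\<lambda>N s. partial_sum lam d s N) l sequentially"
      by (auto simp: uniformly_convergent_on_def)
    then have "(\<lambda>N. partial_sum lam d (of_real \<sigma>) N) \<longlonglongrightarrow> l (of_real \<sigma>)"
      by (rule tendsto_uniform_limitI) (use \<sigma> in simp)
    then have "Cauchy (\<lambda>N. partial_sum lam d (of_real \<sigma>) N)" by (rule LIMSEQ_imp_Cauchy)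
    then obtain N0 where N0: "\<And>m n. N0 \<le> m \<Longrightarrow> N0 \<le> n \<Longrightarrow>
        dist (partial_sum lam d (of_real \<sigma>) m) (partial_sum lam d (of_real \<sigma>) n) < 1"
      unfolding Cauchy_def by (meson zero_less_one)
    obtain N where N: "mm N0 \<le> N" "N \<le> mm (Suc N0)" "norm (partial_sum lam (q N0) (of_real \<sigma>) N) = 1"
      using q[of N0] by (auto simp: hump_def)
    have "dist (partial_sum lam d (of_real \<sigma>) N) (partial_sum lam d (of_real \<sigma>) (mm N0)) < 1"
      using j_le[of N0] N(1) by (intro N0) auto
    then show False using N by (simp add: block[OF N(1,2)] dist_norm)
  qed
  then obtain C where C: "\<And>a E M N. (\<And>s. 0 < Re s \<Longrightarrow> norm (partial_sum lam a s E) \<le> M) \<Longrightarrow> N \<le> E \<Longrightarrow>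
    norm (partial_sum lam a (of_real \<sigma>) N) \<le> C * M"
    by blast
  show thesis
  proof (rule that[of "max C 0"])
    fix a E M N assume M: "\<And>s. 0 < Re s \<Longrightarrow> norm (partial_sum lam a s E) \<le> M" and N: "N \<le> E"
    have "0 \<le> M" using order_trans[OF norm_ge_zero M[of 1]] by simp
    then have "C * M \<le> max C 0 * M" by (intro mult_right_mono) auto
    then show "norm (partial_sum lam a (of_real \<sigma>) N) \<le> max C 0 * M"
      using C[OF M N] by linarith
  qed simp
qed

text \<open>
  A series of the space need not be bounded on \<open>[Re > 0]\<close>, so the Bohr theorem is applied to its
  translate by \<open>\<sigma> / 2\<close>.
\<close>

lemma bohr_uniform_limit:
  assumes freq: "frequency lam" and bohr: "bohr_theorem_holds lam"
    and a: "a \<in> D_infty_plus lam" and \<sigma>: "0 < \<sigma>"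
  shows "uniform_limit (right_half_plane \<sigma>) (\<lambda>N s. partial_sum lam a s N) (dirichlet_limit lam a) sequentially"
proof -
  define w where "w = complex_of_real (\<sigma> / 2)"
  define b where "b = coeff_shift lam w a"
  have conv: "dirichlet_converges lam b 0"
    using D_infty_plus_converges[OF a, of w] \<sigma>
    by (simp add: b_def w_def dirichlet_converges_def dirichlet_term_coeff_shift)
  have "bounded (dirichlet_limit lam a ` right_half_plane (\<sigma> / 2))"
    using a half_gt_zero[OF \<sigma>] unfolding D_infty_plus_def by blast
  then have "bounded (dirichlet_limit lam b ` right_half_plane 0)"
    by (rule bounded_subset) (force simp: b_def w_def dirichlet_limit_coeff_shift)
  then have "b \<in> D_infty_ext lam"
    unfolding D_infty_ext_def using conv dirichlet_limit_holomorphic[OF freq conv] by auto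
  then have "sigma_u lam b \<le> 0" using bohr by (simp add: bohr_theorem_holds_def)
  then have "uniformly_convergent_on (right_half_plane (\<sigma> / 2)) (\<lambda>N s. partial_sum lam b s N)"
    using \<sigma> by (intro sigma_u_nonposD) auto
  then obtain l where l: "uniform_limit (right_half_plane (\<sigma> / 2)) (\<lambda>N s. partial_sum lam b s N) l sequentially"
    by (auto simp: uniformly_convergent_on_def)
  have l_eq: "l (s - w) = dirichlet_limit lam a s" if "\<sigma> < Re s" for s
  proof (rule LIMSEQ_unique)
    show "partial_sum lam b (s - w) \<longlonglongrightarrow> l (s - w)"
      by (rule tendsto_uniform_limitI[OF l]) (use that in \<open>simp add: w_def\<close>)
    show "partial_sum lam b (s - w) \<longlonglongrightarrow> dirichlet_limit lam a s"
      unfolding b_def dirichlet_term_coeff_shift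
      using partial_sum_tendsto[OF D_infty_plus_converges[OF a, of s]] that \<sigma> by simp
  qed
  show ?thesis
  proof (rule uniform_limitI)
    fix e :: real assume "0 < e"
    from uniform_limitD[OF l this]
    show "\<forall>\<^sub>F N in sequentially. \<forall>s\<in>right_half_plane \<sigma>. dist (partial_sum lam a s N) (dirichlet_limit lam a s) < e"
    proof eventually_elim
      case (elim N)
      show ?case
      proof
        fix s assume s: "s \<in> right_half_plane \<sigma>"
        then have "s - w \<in> right_half_plane (\<sigma> / 2)" by (simp add: w_def)
        then have "dist (partial_sum lam b (s - w) N) (l (s - w)) < e" using elim by blast
        then show "dist (partial_sum lam a s N) (dirichlet_limit lam a s) < e"
          using l_eq[of s] s by (simp add: b_def dirichlet_term_coeff_shift)
      qed
    qed
  qed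
qed

text \<open>
  Translating by \<open>w = s - \<sigma> / 2\<close> moves the point \<open>s\<close> to \<open>\<sigma> / 2\<close>,
  and a long partial sum of the translate is a polynomial that is almost bounded by the norm of the series, because
  the partial sums converge uniformly on \<open>[Re > \<sigma> / 2]\<close>. The polynomial bound at \<open>\<sigma> /
  2\<close> then applies.
\<close>

lemma bohr_partial_sum_bound:
  assumes freq: "frequency lam" and bohr: "bohr_theorem_holds lam" and \<sigma>: "0 < \<sigma>"
  obtains C k where "0 \<le> C" "1 \<le> k" "\<And>a s N. a \<in> D_infty_plus lam \<Longrightarrow> \<sigma> \<le> Re s \<Longrightarrow>
    norm (partial_sum lam a s N) \<le> C * D_infty_plus_norm lam k a"
proof -
  obtain k where k: "1 \<le> k" "1 / real k < \<sigma> / 2" using inverse_nat_less[of "\<sigma> / 2"] \<sigma> by auto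
  obtain C where C: "0 \<le> C" "\<And>a E M N. (\<And>s. 0 < Re s \<Longrightarrow> norm (partial_sum lam a s E) \<le> M) \<Longrightarrow> N \<le> E \<Longrightarrow>
    norm (partial_sum lam a (of_real (\<sigma> / 2)) N) \<le> C * M"
    using bohr_polynomial_bound[OF freq bohr, of "\<sigma> / 2"] \<sigma> half_gt_zero by blast
  have "norm (partial_sum lam a s N) \<le> C * D_infty_plus_norm lam k a"
    if a: "a \<in> D_infty_plus lam" and s: "\<sigma> \<le> Re s" for a s N
  proof (rule field_le_epsilon)
    fix e :: real assume e: "0 < e"
    define w where "w = s - of_real (\<sigma> / 2)"
    define \<epsilon> where "\<epsilon> = e / (C + 1)"
    have \<epsilon>: "0 < \<epsilon>" using e C(1) by (simp add: \<epsilon>_def)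
    have "0 < \<sigma> / 2" using \<sigma> by simp
    from uniform_limitD[OF bohr_uniform_limit[OF freq bohr a this] \<epsilon>] eventually_ge_at_top[of N]
    have "\<forall>\<^sub>F L in sequentially. N \<le> L \<and> (\<forall>z\<in>right_half_plane (\<sigma> / 2).
        dist (partial_sum lam a z L) (dirichlet_limit lam a z) < \<epsilon>)"
      by eventually_elim auto
    then obtain L where L: "N \<le> L" "\<And>z. \<sigma> / 2 < Re z \<Longrightarrow>
        dist (partial_sum lam a z L) (dirichlet_limit lam a z) < \<epsilon>"
      unfolding eventually_sequentially by fastforce
    have "norm (partial_sum lam (coeff_shift lam w a) z L) \<le> D_infty_plus_norm lam k a + \<epsilon>"
      if z: "0 < Re z" for z
    proof -
      have zw: "\<sigma> / 2 < Re (z + w)" using z s by (simp add: w_def)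
      have "norm (dirichlet_limit lam a (z + w)) \<le> D_infty_plus_norm lam k a"
        by (rule dirichlet_limit_le_norm[OF a k(1)]) (use zw k in linarith)
      then show ?thesis
        using L(2)[OF zw] norm_triangle_sub[of "partial_sum lam a (z + w) L" "dirichlet_limit lam a (z + w)"]
        unfolding dirichlet_term_coeff_shift dist_norm by linarith
    qed
    then have "norm (partial_sum lam (coeff_shift lam w a) (of_real (\<sigma> / 2)) N)
        \<le> C * (D_infty_plus_norm lam k a + \<epsilon>)"
      by (rule C(2)[OF _ L(1)])
    also have "\<dots> \<le> C * D_infty_plus_norm lam k a + e"
      using C(1) e by (simp add: \<epsilon>_def field_simps)
    finally show "norm (partial_sum lam a s N) \<le> C * D_infty_plus_norm lam k a + e"
      by (simp add: dirichlet_term_coeff_shift w_def)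
  qed
  then show thesis using C(1) k(1) that by blast
qed

section \<open>Compactness of norm-bounded sets\<close>

lemma D_infty_plus_norm_minus_commute:
  assumes "a \<in> D_infty_plus lam" "b \<in> D_infty_plus lam" "1 \<le> k"
  shows "D_infty_plus_norm lam k (a - b) = D_infty_plus_norm lam k (b - a)"
proof -
  have "a - b = coeff_scale (-1) (b - a)" by (simp add: coeff_scale_def fun_eq_iff)
  then show ?thesis
    using D_infty_plus_norm_scale[OF D_infty_plus_diff[OF assms(2,1)] assms(3), of "-1"] by simp
qed

definition norm_bounded_set :: "(nat \<Rightarrow> real) \<Rightarrow> (nat \<Rightarrow> real) \<Rightarrow> (nat \<Rightarrow> complex) set" where
  "norm_bounded_set lam B = {a \<in> D_infty_plus lam. \<forall>k\<ge>1. D_infty_plus_norm lam k a \<le> B k}"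

lemma norm_bounded_set_partial_sum_bound:
  assumes freq: "frequency lam" and bohr: "bohr_theorem_holds lam" and \<sigma>: "0 < \<sigma>"
  obtains K where "\<And>a s N. a \<in> norm_bounded_set lam B \<Longrightarrow> \<sigma> \<le> Re s \<Longrightarrow> norm (partial_sum lam a s N) \<le> K"
proof -
  obtain C k where C: "0 \<le> C" "1 \<le> k" "\<And>a s N. a \<in> D_infty_plus lam \<Longrightarrow> \<sigma> \<le> Re s \<Longrightarrow>
    norm (partial_sum lam a s N) \<le> C * D_infty_plus_norm lam k a"
    using bohr_partial_sum_bound[OF freq bohr \<sigma>] by blast
  show thesis
  proof (rule that[of "C * B k"])
    fix a s N assume a: "a \<in> norm_bounded_set lam B" and s: "\<sigma> \<le> Re s"
    then have "C * D_infty_plus_norm lam k a \<le> C * B k"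
      using C(1,2) by (intro mult_left_mono) (auto simp: norm_bounded_set_def)
    moreover have "a \<in> D_infty_plus lam" using a by (simp add: norm_bounded_set_def)
    ultimately show "norm (partial_sum lam a s N) \<le> C * B k" using C(3)[of a s N] s by linarith
  qed
qed

lemma dirichlet_limit_diff_bound:
  assumes freq: "frequency lam" and \<sigma>: "0 \<le> \<sigma>" and \<delta>: "0 < \<delta>"
    and a: "\<And>s N. \<sigma> \<le> Re s \<Longrightarrow> norm (partial_sum lam a s N) \<le> K"
    and b: "\<And>s N. \<sigma> \<le> Re s \<Longrightarrow> norm (partial_sum lam b s N) \<le> K"
    and s: "\<sigma> + \<delta> \<le> Re s"
  shows "norm (dirichlet_limit lam a s - dirichlet_limit lam b s)
    \<le> 4 * K * exp (- (lam m * \<delta>)) + (\<Sum>n<m. norm (a n - b n))"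
proof -
  have "norm (partial_sum lam (a - b) s m) \<le> (\<Sum>n<m. norm ((a - b) n))"
    by (rule partial_sum_norm_le[OF freq]) (use s \<sigma> \<delta> in simp)
  then have 1: "norm (partial_sum lam a s m - partial_sum lam b s m) \<le> (\<Sum>n<m. norm (a n - b n))"
    by (simp add: partial_sum_diff)
  have 2: "norm (dirichlet_limit lam a s - partial_sum lam a s m) \<le> 2 * K * exp (- (lam m * \<delta>))"
    by (rule half_plane_tail_bound[OF freq a \<delta> s])
  have 3: "norm (dirichlet_limit lam b s - partial_sum lam b s m) \<le> 2 * K * exp (- (lam m * \<delta>))"
    by (rule half_plane_tail_bound[OF freq b \<delta> s])
  have "norm (u - v) \<le> norm (u - u') + norm (u' - v') + norm (v - v')" for u v u' v' :: complex
    using norm_triangle_ineq4[of "(u - u') + (u' - v')" "v - v'"] norm_triangle_ineq[of "u - u'" "u' - v'"]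
    by simp
  from this[of "dirichlet_limit lam a s" "dirichlet_limit lam b s" "partial_sum lam a s m" "partial_sum lam b s m"]
  show ?thesis using 1 2 3 by linarith
qed

text \<open>
  The tails of all series in the set are uniformly small, so closeness of finitely many coefficients
  already implies closeness in a given norm.
\<close>

lemma norm_bounded_set_coefficientwise:
  assumes freq: "frequency lam" and bohr: "bohr_theorem_holds lam" and k: "1 \<le> k" and e: "0 < e"
  shows "\<exists>N. \<exists>\<delta>>0. \<forall>a\<in>norm_bounded_set lam B. \<forall>b\<in>norm_bounded_set lam B.
    (\<forall>n<N. norm (a n - b n) < \<delta>) \<longrightarrow> D_infty_plus_norm lam k (a - b) < e"
proof -
  define \<sigma> where "\<sigma> = 1 / (2 * real k)"
  have \<sigma>: "0 < \<sigma>" "\<sigma> + \<sigma> = 1 / real k" using k by (auto simp: \<sigma>_def)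
  obtain K where K: "\<And>a s N. a \<in> norm_bounded_set lam B \<Longrightarrow> \<sigma> \<le> Re s \<Longrightarrow> norm (partial_sum lam a s N) \<le> K"
    using norm_bounded_set_partial_sum_bound[OF freq bohr \<sigma>(1)] by blast
  have "(\<lambda>m. 4 * K * exp (- (lam m * \<sigma>))) \<longlonglongrightarrow> 0"
    by (rule tendsto_mult_right_zero[OF exp_frequency_tendsto_0[OF freq \<sigma>(1)]])
  then have "\<forall>\<^sub>F m in sequentially. 4 * K * exp (- (lam m * \<sigma>)) < e / 4"
    using e by (intro order_tendstoD) auto
  then obtain N where N: "4 * K * exp (- (lam N * \<sigma>)) < e / 4"
    by (auto simp: eventually_sequentially)
  define \<delta> where "\<delta> = e / (4 * (real N + 1))"
  have \<delta>: "0 < \<delta>" using e by (simp add: \<delta>_def)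
  show ?thesis
  proof (intro exI[of _ N] exI[of _ \<delta>] conjI \<delta> ballI impI)
    fix a b assume a: "a \<in> norm_bounded_set lam B" and b: "b \<in> norm_bounded_set lam B"
      and ab: "\<forall>n<N. norm (a n - b n) < \<delta>"
    have V: "a \<in> D_infty_plus lam" "b \<in> D_infty_plus lam"
      using a b by (auto simp: norm_bounded_set_def)
    have "(\<Sum>n<N. norm (a n - b n)) \<le> (\<Sum>n<N. \<delta>)"
      by (rule sum_mono) (use ab less_imp_le in auto)
    also have "\<dots> \<le> e / 4" using e by (simp add: \<delta>_def field_simps)
    finally have sum: "(\<Sum>n<N. norm (a n - b n)) \<le> e / 4" .
    have "D_infty_plus_norm lam k (a - b) \<le> e / 2"
    proof (rule D_infty_plus_norm_le)
      fix s assume s: "1 / real k < Re s"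
      have "norm (dirichlet_limit lam a s - dirichlet_limit lam b s)
        \<le> 4 * K * exp (- (lam N * \<sigma>)) + (\<Sum>n<N. norm (a n - b n))"
        by (rule dirichlet_limit_diff_bound[OF freq _ \<sigma>(1) K[OF a] K[OF b]]) (use s \<sigma> in auto)
      moreover have "0 < Re s" using s order_le_less_trans[of 0 "1 / real k" "Re s"] by simp
      ultimately show "norm (dirichlet_limit lam (a - b) s) \<le> e / 2"
        using N sum by (simp add: dirichlet_limit_diff[OF V])
    qed
    then show "D_infty_plus_norm lam k (a - b) < e" using e by simp
  qed
qed

text \<open>
  The uniform bounds for partial sums survive a limit taken coefficient by coefficient, and they imply
  convergence of the limit series on \<open>[Re > 0]\<close>. The norm bounds survive as well, because the limit functions
  converge.
\<close>

lemma norm_bounded_set_coefficientwise_closed: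
  assumes freq: "frequency lam" and bohr: "bohr_theorem_holds lam"
    and x: "\<And>i. x i \<in> norm_bounded_set lam B" and lim: "\<And>n. (\<lambda>i. x i n) \<longlonglongrightarrow> a n"
  shows "a \<in> norm_bounded_set lam B"
proof -
  have partial: "\<exists>K. (\<forall>s N. \<sigma> \<le> Re s \<longrightarrow> norm (partial_sum lam a s N) \<le> K) \<and>
      (\<forall>i s N. \<sigma> \<le> Re s \<longrightarrow> norm (partial_sum lam (x i) s N) \<le> K)" if \<sigma>: "0 < \<sigma>" for \<sigma>
  proof -
    obtain K where K: "\<And>a s N. a \<in> norm_bounded_set lam B \<Longrightarrow> \<sigma> \<le> Re s \<Longrightarrow> norm (partial_sum lam a s N) \<le> K"
      using norm_bounded_set_partial_sum_bound[OF freq bohr \<sigma>] by blast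
    have "norm (partial_sum lam a s N) \<le> K" if "\<sigma> \<le> Re s" for s N
    proof (rule Lim_norm_ubound[OF sequentially_bot])
      show "(\<lambda>i. partial_sum lam (x i) s N) \<longlonglongrightarrow> partial_sum lam a s N"
        unfolding dirichlet_term_def by (intro tendsto_intros lim)
      show "\<forall>\<^sub>F i in sequentially. norm (partial_sum lam (x i) s N) \<le> K"
        using K[OF x that] by simp
    qed
    then show ?thesis using K[OF x] by blast
  qed
  have bound: "norm (dirichlet_limit lam a s) \<le> B k" if k: "1 \<le> k" and s: "1 / real k < Re s" for k s
  proof -
    define \<sigma> where "\<sigma> = 1 / (2 * real k)"
    have \<sigma>: "0 < \<sigma>" "\<sigma> + \<sigma> = 1 / real k" using k by (auto simp: \<sigma>_def)
    obtain K where K: "\<And>s N. \<sigma> \<le> Re s \<Longrightarrow> norm (partial_sum lam a s N) \<le> K"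
      "\<And>i s N. \<sigma> \<le> Re s \<Longrightarrow> norm (partial_sum lam (x i) s N) \<le> K"
      using partial[OF \<sigma>(1)] by blast
    have 1: "norm (dirichlet_limit lam a s)
        \<le> B k + 4 * K * exp (- (lam m * \<sigma>)) + (\<Sum>n<m. norm (a n - x i n))" for i m
    proof -
      have "norm (dirichlet_limit lam a s - dirichlet_limit lam (x i) s)
          \<le> 4 * K * exp (- (lam m * \<sigma>)) + (\<Sum>n<m. norm (a n - x i n))"
        by (rule dirichlet_limit_diff_bound[OF freq _ \<sigma>(1) K]) (use s \<sigma> in auto)
      moreover have "norm (dirichlet_limit lam (x i) s) \<le> B k"
        using dirichlet_limit_le_norm[of "x i" lam k s] x[of i] k s by (force simp: norm_bounded_set_def)
      ultimately show ?thesis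
        using norm_triangle_sub[of "dirichlet_limit lam a s" "dirichlet_limit lam (x i) s"] by linarith
    qed
    \<comment> \<open>First \<open>i \<rightarrow> \<infinity>\<close> for fixed \<open>m\<close>, afterwards \<open>m \<rightarrow> \<infinity>\<close>.\<close>
    have 2: "norm (dirichlet_limit lam a s) \<le> B k + 4 * K * exp (- (lam m * \<sigma>)) + (\<Sum>n<m. norm (a n - a n))" for m
      by (rule LIMSEQ_le_const[where X = "\<lambda>i. B k + 4 * K * exp (- (lam m * \<sigma>)) + (\<Sum>n<m. norm (a n - x i n))"])
        (intro tendsto_intros lim, use 1 in blast)
    have "(\<lambda>m. B k + 4 * K * exp (- (lam m * \<sigma>))) \<longlonglongrightarrow> B k + 0"
      by (intro tendsto_intros tendsto_mult_right_zero[OF exp_frequency_tendsto_0[OF freq \<sigma>(1)]])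
    then have "norm (dirichlet_limit lam a s) \<le> B k + 0"
      by (rule LIMSEQ_le_const) (use 2 in auto)
    then show ?thesis by simp
  qed
  have "dirichlet_converges lam a s" if s: "0 < Re s" for s
  proof -
    obtain K where "\<And>s' N. Re s / 2 \<le> Re s' \<Longrightarrow> norm (partial_sum lam a s' N) \<le> K"
      using partial[of "Re s / 2"] s by auto
    then have "\<And>N. norm (partial_sum lam a (s / 2) N) \<le> K" by simp
    then show ?thesis by (rule bounded_partial_sums_converges[OF freq]) (use s in simp)
  qed
  then have "a \<in> D_infty_plus lam" by (rule D_infty_plusI[where B = B]) (use bound in auto)
  then show ?thesis
    unfolding norm_bounded_set_def using D_infty_plus_norm_le[OF bound] by blast
qed

lemma tendsto_coefficient:
  fixes l :: "nat \<Rightarrow> complex"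
  assumes "x \<longlonglongrightarrow> l" shows "(\<lambda>i. x i n) \<longlonglongrightarrow> l n"
  by (rule continuous_on_tendsto_compose[OF continuous_on_product_coordinates[of n] assms]) auto

text \<open>
  Compactness is meant in the product topology of the sequence space: the coefficient bounds put the set
  into a product of discs, in which it is closed.
\<close>

lemma compact_norm_bounded_set:
  assumes freq: "frequency lam" and bohr: "bohr_theorem_holds lam"
  shows "compact (norm_bounded_set lam B)"
proof -
  define S where "S n = cball (0::complex) (B 1 * exp (lam n * 2))" for n
  have "compactin (product_topology (\<lambda>_::nat. euclidean) UNIV) (PiE UNIV S)"
    unfolding compactin_PiE by (simp add: S_def)
  then have "compact (PiE UNIV S)" by (simp add: euclidean_product_topology)
  moreover have "norm_bounded_set lam B \<subseteq> PiE UNIV S"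
  proof
    fix a assume a: "a \<in> norm_bounded_set lam B"
    then have V: "a \<in> D_infty_plus lam" and B: "D_infty_plus_norm lam 1 a \<le> B 1"
      by (auto simp: norm_bounded_set_def)
    have "norm (a n) \<le> B 1 * exp (lam n * 2)" for n
      by (rule order_trans[OF D_infty_plus_coefficient_bound[OF freq V order_refl] mult_right_mono[OF B exp_ge_zero]])
    then show "a \<in> PiE UNIV S" by (auto simp: S_def)
  qed
  moreover have "closed (norm_bounded_set lam B)"
    unfolding closed_sequential_limits
  proof (intro allI impI, elim conjE)
    fix x l assume "\<forall>n. x n \<in> norm_bounded_set lam B" and l: "x \<longlonglongrightarrow> l"
    then show "l \<in> norm_bounded_set lam B"
      by (intro norm_bounded_set_coefficientwise_closed[OF freq bohr _ tendsto_coefficient[OF l]]) auto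
  qed
  ultimately show ?thesis by (metis compact_Int_closed Int_absorb1)
qed

text \<open>
  By \<open>norm_bounded_set_coefficientwise\<close> the identity is continuous from the product topology on
  the set to the topology of the space, so compactness is transferred.
\<close>

lemma compactin_norm_bounded_set:
  assumes freq: "frequency lam" and bohr: "bohr_theorem_holds lam"
  shows "compactin (D_infty_plus_topology lam) (norm_bounded_set lam B)"
proof -
  let ?K = "norm_bounded_set lam B"
  have "continuous_map (top_of_set ?K) (D_infty_plus_topology lam) id"
    unfolding continuous_map_def
  proof (intro conjI allI impI)
    show "id \<in> topspace (top_of_set ?K) \<rightarrow> topspace (D_infty_plus_topology lam)"
      by (auto simp: topspace_D_infty_plus norm_bounded_set_def)
    fix W assume W: "openin (D_infty_plus_topology lam) W"
    have "\<exists>T. openin (top_of_set ?K) T \<and> x \<in> T \<and> T \<subseteq> {x \<in> ?K. x \<in> W}" if x: "x \<in> ?K" "x \<in> W" for x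
    proof -
      obtain k e where k: "1 \<le> k" "0 < e"
        and ke: "\<And>y. y \<in> D_infty_plus lam \<Longrightarrow> D_infty_plus_norm lam k (y - x) < e \<Longrightarrow> y \<in> W"
        using W x(2) unfolding openin_D_infty_plus_topology by blast
      obtain N \<delta> where \<delta>: "0 < \<delta>" and N: "\<And>a b. a \<in> ?K \<Longrightarrow> b \<in> ?K \<Longrightarrow>
          \<forall>n<N. norm (a n - b n) < \<delta> \<Longrightarrow> D_infty_plus_norm lam k (a - b) < e"
        using norm_bounded_set_coefficientwise[OF freq bohr k, of B] by blast
      let ?O = "\<Inter>n<N. {y. norm (y n - x n) < \<delta>}"
      have "open ?O"
        by (intro open_INT ballI open_Collect_less continuous_intros continuous_on_product_coordinates) auto
      then have "openin (top_of_set ?K) (?K \<inter> ?O)" by blast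
      moreover have "?K \<inter> ?O \<subseteq> {x \<in> ?K. x \<in> W}"
        using N[OF _ x(1)] by (auto intro!: ke simp: norm_bounded_set_def)
      ultimately show ?thesis using x(1) \<delta> by (intro exI[of _ "?K \<inter> ?O"]) auto
    qed
    then show "openin (top_of_set ?K) {x \<in> topspace (top_of_set ?K). id x \<in> W}"
      by (subst openin_subopen) auto
  qed
  moreover have "compactin (top_of_set ?K) ?K"
    using compact_norm_bounded_set[OF freq bohr, of B] by (simp add: compactin_subtopology)
  ultimately have "compactin (D_infty_plus_topology lam) (id ` ?K)"
    by (intro image_compactin)
  then show ?thesis by simp
qed

theorem bohr_imp_semi_montel:
  assumes freq: "frequency lam" and bohr: "bohr_theorem_holds lam"
  shows "semi_montel_space coeff_scale (D_infty_plus_topology lam)"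
  unfolding semi_montel_space_def
proof (intro allI impI)
  let ?V = "D_infty_plus lam" and ?n = "D_infty_plus_norm lam" and ?T = "D_infty_plus_topology lam"
  fix B assume "bounded_in_lcs coeff_scale ?T B"
  then obtain C where C: "\<And>a k. a \<in> B \<Longrightarrow> 1 \<le> k \<Longrightarrow> a \<in> ?V \<and> ?n k a \<le> C k"
    using bounded_in_D_infty_plus by blast
  then have sub: "B \<subseteq> norm_bounded_set lam C" unfolding norm_bounded_set_def by blast
  have "closedin ?T (norm_bounded_set lam C)"
    unfolding closedin_D_infty_plus_topology
  proof (intro conjI ballI)
    show "norm_bounded_set lam C \<subseteq> ?V" by (auto simp: norm_bounded_set_def)
    fix x assume "x \<in> ?V - norm_bounded_set lam C"
    then obtain k where x: "x \<in> ?V" and k: "1 \<le> k" "C k < ?n k x"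
      by (auto simp: norm_bounded_set_def not_le)
    have "y \<notin> norm_bounded_set lam C" if y: "y \<in> ?V" and yx: "?n k (y - x) < ?n k x - C k" for y
    proof
      assume "y \<in> norm_bounded_set lam C"
      then have "?n k y \<le> C k" using k by (simp add: norm_bounded_set_def)
      moreover have "?n k x \<le> ?n k (x - y) + ?n k y"
        using D_infty_plus_norm_triangle[OF D_infty_plus_diff[OF x y] y k(1)] by simp
      ultimately show False using yx D_infty_plus_norm_minus_commute[OF x y k(1)] by linarith
    qed
    then show "\<exists>k\<ge>1. \<exists>e>0. \<forall>y\<in>?V. ?n k (y - x) < e \<longrightarrow> y \<notin> norm_bounded_set lam C"
      using k by (intro exI[of _ k] conjI exI[of _ "?n k x - C k"]) auto
  qed
  then have "?T closure_of B \<subseteq> norm_bounded_set lam C" by (rule closure_of_minimal[OF sub])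
  then show "compactin ?T (?T closure_of B)"
    by (rule closed_compactin[OF compactin_norm_bounded_set[OF freq bohr]]) simp
qed

section \<open>Barrelledness from the Bohr theorem\<close>

text \<open>
  The Baire category argument. If the closed sets \<open>G n\<close>, the multiples of \<open>A\<close> by \<open>n +
  1\<close>, all had empty interior, one could choose nested closed balls, the \<open>n\<close>-th choice avoiding
  \<open>G n\<close>. Their centres are bounded in every norm, so by compactness a subsequence converges, and the
  limit lies in every ball. It belongs to no \<open>G n\<close>, contrary to \<open>A\<close> being absorbing.
\<close>

lemma barrel_absorbs_some_ball:
  assumes freq: "frequency lam" and bohr: "bohr_theorem_holds lam"
    and cl: "closedin (D_infty_plus_topology lam) A"
    and ab: "absorbing coeff_scale (D_infty_plus_topology lam) A"
  shows "\<exists>n x k e. x \<in> D_infty_plus lam \<and> 1 \<le> k \<and> 0 < e \<and>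
    (\<forall>y\<in>D_infty_plus lam. D_infty_plus_norm lam k (y - x) < e \<longrightarrow>
      coeff_scale (of_real (1 / real (Suc n))) y \<in> A)"
proof (rule ccontr)
  let ?V = "D_infty_plus lam" and ?n = "D_infty_plus_norm lam"
  define G where "G n = {y. coeff_scale (of_real (1 / real (Suc n))) y \<in> A}" for n
  assume "\<not> ?thesis"
  then have thin: "\<exists>y\<in>?V. ?n k (y - x) < e \<and> y \<notin> G n" if "x \<in> ?V" "1 \<le> k" "0 < e" for n x k e
    using that unfolding G_def by blast
  \<comment> \<open>A triple \<open>(x, k, e)\<close> stands for the closed ball of radius \<open>e\<close> around \<open>x\<close> in the \<open>k\<close>-th norm.
    The condition \<open>n \<le> k\<close> lets the norm of the \<open>n\<close>-th ball dominate the \<open>n\<close>-th norm, so that the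
    centres are bounded in every norm.\<close>
  define P where "P n t = (case t of (x, k, e) \<Rightarrow> x \<in> ?V \<and> (1::nat) \<le> k \<and> n \<le> k \<and> (0::real) < e)" for n t
  define Q where "Q n t t' = (case (t, t') of ((x, k, e), (x', k', e')) \<Rightarrow>
    \<forall>z\<in>?V. ?n k' (z - x') \<le> e' \<longrightarrow> ?n k (z - x) \<le> e \<and> z \<notin> G n)" for n t t'
  have "\<exists>t. P 0 t"
    unfolding P_def using zero_in_D_infty_plus by (intro exI[of _ "(0, 1, 1)"]) auto
  moreover have "\<exists>t'. P (Suc n) t' \<and> Q n t t'" if "P n t" for t n
  proof -
    obtain x k e where t: "t = (x, k, e)" by (cases t) auto
    have x: "x \<in> ?V" "1 \<le> k" "n \<le> k" "0 < e" using that by (auto simp: t P_def)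
    obtain y where y: "y \<in> ?V" "?n k (y - x) < e" "y \<notin> G n" using thin[of x k e n] x by blast
    define c where "c = complex_of_real (1 / real (Suc n))"
    have c: "norm c \<le> 1" by (simp add: c_def norm_divide del: of_nat_Suc)
    have "coeff_scale c y \<in> ?V - A" using y by (auto simp: G_def c_def intro: D_infty_plus_scale)
    then obtain j r where j: "1 \<le> j" "0 < r"
      and jr: "\<And>z. z \<in> ?V \<Longrightarrow> ?n j (z - coeff_scale c y) < r \<Longrightarrow> z \<notin> A"
      using cl unfolding closedin_D_infty_plus_topology by blast
    define k' where "k' = max (max k j) (Suc n)"
    define e' where "e' = min r (e - ?n k (y - x)) / 2"
    have e': "0 < e'" "e' < r" "e' < e - ?n k (y - x)"
      using j y by (auto simp: e'_def min_def)
    have "?n k (z - x) \<le> e \<and> z \<notin> G n" if z: "z \<in> ?V" "?n k' (z - y) \<le> e'" for z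
    proof
      have zy: "z - y \<in> ?V" by (rule D_infty_plus_diff[OF z(1) y(1)])
      have "?n k (z - x) \<le> ?n k (z - y) + ?n k (y - x)"
        by (rule D_infty_plus_norm_diff_triangle[OF z(1) y(1) x(1,2)])
      moreover have "?n k (z - y) \<le> ?n k' (z - y)"
        by (rule D_infty_plus_norm_mono[OF zy x(2)]) (simp add: k'_def)
      ultimately show "?n k (z - x) \<le> e" using z(2) e' by linarith
      have "coeff_scale c z - coeff_scale c y = coeff_scale c (z - y)"
        by (simp add: coeff_scale_def fun_eq_iff algebra_simps)
      then have "?n j (coeff_scale c z - coeff_scale c y) = norm c * ?n j (z - y)"
        using D_infty_plus_norm_scale[OF zy j(1)] by simp
      also have "\<dots> \<le> 1 * ?n j (z - y)"
        by (rule mult_right_mono[OF c D_infty_plus_norm_nonneg[OF zy j(1)]])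
      also have "\<dots> \<le> ?n k' (z - y)"
        using D_infty_plus_norm_mono[OF zy j(1), of k'] by (simp add: k'_def)
      also have "\<dots> < r" using z(2) e' by linarith
      finally have "coeff_scale c z \<notin> A" by (rule jr[OF D_infty_plus_scale[OF z(1)]])
      then show "z \<notin> G n" by (simp add: G_def c_def)
    qed
    then have "P (Suc n) (y, k', e') \<and> Q n t (y, k', e')"
      using y(1) e'(1) x(2) by (auto simp: P_def Q_def t k'_def)
    then show ?thesis by blast
  qed
  ultimately obtain t where t: "\<And>n. P n (t n)" "\<And>n. Q n (t n) (t (Suc n))"
    using dependent_nat_choice[of P Q] by metis
  define X where "X n = fst (t n)" for n
  define k where "k n = fst (snd (t n))" for n
  define e where "e n = snd (snd (t n))" for n
  have PX: "X n \<in> ?V" "1 \<le> k n" "n \<le> k n" "0 < e n" for n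
    using t(1)[of n] by (auto simp: P_def X_def k_def e_def split: prod.splits)
  have QX: "?n (k n) (z - X n) \<le> e n \<and> z \<notin> G n"
    if "z \<in> ?V" "?n (k (Suc n)) (z - X (Suc n)) \<le> e (Suc n)" for n z
    using t(2)[of n] that by (auto simp: Q_def X_def k_def e_def split: prod.splits)
  have nested: "?n (k j) (z - X j) \<le> e j"
    if "j \<le> i" "z \<in> ?V" "?n (k i) (z - X i) \<le> e i" for i j z
    using that(1,3)
  proof (induction i rule: dec_induct)
    case (step i)
    then show ?case using QX[OF that(2), of i] by blast
  qed
  have X_in: "?n (k j) (X i - X j) \<le> e j" if "j \<le> i" for i j
    by (rule nested[OF that PX(1)]) (use PX(4)[of i] in \<open>simp add: D_infty_plus_norm_0\<close>)
  \<comment> \<open>From index \<open>m\<close> on the centres lie in the \<open>m\<close>-th ball, whose norm dominates the norm of index \<open>m\<close>;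
    the finite sum accounts for the earlier centres.\<close>
  define B where "B m = e m + ?n (k m) (X m) + (\<Sum>i<m. ?n m (X i))" for m
  have "X i \<in> norm_bounded_set lam B" for i
    unfolding norm_bounded_set_def
  proof (intro CollectI conjI PX allI impI)
    fix m :: nat assume m: "1 \<le> m"
    have nonneg: "0 \<le> ?n m (X i)" for i by (rule D_infty_plus_norm_nonneg[OF PX(1) m])
    show "?n m (X i) \<le> B m"
    proof (cases "i < m")
      case True
      then have "?n m (X i) \<le> (\<Sum>i<m. ?n m (X i))"
        by (intro member_le_sum) (use nonneg in auto)
      then show ?thesis
        using PX(4)[of m] D_infty_plus_norm_nonneg[OF PX(1)[of m] PX(2)[of m]] unfolding B_def by linarith
    next
      case False
      have "?n m (X i) \<le> ?n (k m) (X i)"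
        by (rule D_infty_plus_norm_mono[OF PX(1) m PX(3)])
      also have "\<dots> \<le> ?n (k m) (X i - X m) + ?n (k m) (X m)"
        using D_infty_plus_norm_triangle[OF D_infty_plus_diff[OF PX(1)[of i] PX(1)[of m]] PX(1)[of m] PX(2)[of m]]
        by simp
      finally show ?thesis
        using X_in[of m i] False sum_nonneg[of "{..<m}" "\<lambda>i. ?n m (X i)"] nonneg unfolding B_def by force
    qed
  qed
  moreover have "seq_compact (norm_bounded_set lam B)"
    using compact_norm_bounded_set[OF freq bohr] compact_eq_seq_compact_metric by blast
  ultimately obtain l r where l: "l \<in> norm_bounded_set lam B" and r: "strict_mono r"
    and lim: "(X \<circ> r) \<longlonglongrightarrow> l" and XK: "\<And>i. X i \<in> norm_bounded_set lam B"
    using seq_compactE[of "norm_bounded_set lam B" X] by metis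
  have lV: "l \<in> ?V" using l by (simp add: norm_bounded_set_def)
  have "?n (k j) (l - X j) \<le> e j" for j
  proof (rule field_le_epsilon)
    fix d :: real assume d: "0 < d"
    obtain N \<delta> where \<delta>: "0 < \<delta>" and N: "\<And>a b. a \<in> norm_bounded_set lam B \<Longrightarrow> b \<in> norm_bounded_set lam B \<Longrightarrow>
        \<forall>n<N. norm (a n - b n) < \<delta> \<Longrightarrow> ?n (k j) (a - b) < d"
      using norm_bounded_set_coefficientwise[OF freq bohr PX(2)[of j] d, of B] by blast
    have "\<forall>\<^sub>F i in sequentially. \<forall>n\<in>{..<N}. dist ((X \<circ> r) i n) (l n) < \<delta>"
      by (intro eventually_ball_finite ballI tendstoD[OF tendsto_coefficient[OF lim] \<delta>]) simp
    then have "\<forall>\<^sub>F i in sequentially. j \<le> i \<and> (\<forall>n\<in>{..<N}. dist ((X \<circ> r) i n) (l n) < \<delta>)"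
      using eventually_ge_at_top[of j] by eventually_elim auto
    then obtain i where i: "j \<le> i" "\<forall>n<N. norm (l n - X (r i) n) < \<delta>"
      unfolding eventually_sequentially by (force simp: dist_norm norm_minus_commute)
    have "?n (k j) (l - X j) \<le> ?n (k j) (l - X (r i)) + ?n (k j) (X (r i) - X j)"
      by (rule D_infty_plus_norm_diff_triangle[OF lV PX(1) PX(1) PX(2)])
    moreover have "?n (k j) (l - X (r i)) < d" by (rule N[OF l XK i(2)])
    moreover have "?n (k j) (X (r i) - X j) \<le> e j"
      using i(1) strict_mono_imp_increasing[OF r, of i] by (intro X_in) simp
    ultimately show "?n (k j) (l - X j) \<le> e j + d" by linarith
  qed
  then have notG: "l \<notin> G n" for n using QX[OF lV] by blast
  obtain R where R: "0 < R" "\<And>c. R \<le> norm c \<Longrightarrow> {l} \<subseteq> coeff_scale c ` A"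
    using ab lV by (auto simp: absorbing_def absorbs_def topspace_D_infty_plus)
  obtain n where n: "R \<le> real n" using real_arch_simple by blast
  have "R \<le> norm (complex_of_real (real (Suc n)))" unfolding norm_of_real using n by simp
  then obtain a where "a \<in> A" "l = coeff_scale (of_real (real (Suc n))) a" using R(2) by blast
  then have "l \<in> G n"
    by (simp add: G_def coeff_scale_def mult.assoc[symmetric] del: of_nat_Suc)
  then show False using notG by blast
qed

text \<open>
  A ball of positive radius around some \<open>x\<close> is contained in a multiple of the barrel. Since
  \<open>u = (x + u) / 2 - (x - u) / 2\<close>, absolute convexity moves the ball to the origin.
\<close>

theorem bohr_imp_barrelled:
  assumes freq: "frequency lam" and bohr: "bohr_theorem_holds lam"
  shows "barrelled_space coeff_scale (D_infty_plus_topology lam)"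
  unfolding barrelled_space_def
proof (intro allI impI)
  let ?V = "D_infty_plus lam" and ?n = "D_infty_plus_norm lam"
  fix A assume "barrel coeff_scale (D_infty_plus_topology lam) A"
  then have conv: "absolutely_convex coeff_scale A" and cl: "closedin (D_infty_plus_topology lam) A"
    and ab: "absorbing coeff_scale (D_infty_plus_topology lam) A"
    by (auto simp: barrel_def)
  obtain n x k e where x: "x \<in> ?V" and k: "1 \<le> k" and e: "0 < e"
    and ball: "\<And>y. y \<in> ?V \<Longrightarrow> ?n k (y - x) < e \<Longrightarrow> coeff_scale (of_real (1 / real (Suc n))) y \<in> A"
    using barrel_absorbs_some_ball[OF freq bohr cl ab] by blast
  have "v \<in> A" if v: "v \<in> ?V" "?n k v < e / real (Suc n)" for v
  proof -
    define c where "c = complex_of_real (1 / real (Suc n))"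
    define u where "u = coeff_scale (of_real (real (Suc n))) v"
    have u: "u \<in> ?V" unfolding u_def by (rule D_infty_plus_scale[OF v(1)])
    have "?n k u = norm (complex_of_real (real (Suc n))) * ?n k v"
      unfolding u_def by (rule D_infty_plus_norm_scale[OF v(1) k])
    then have ue: "?n k u < e" using v(2) by (simp add: field_simps del: of_nat_Suc)
    have "coeff_scale c (x + u) \<in> A"
      unfolding c_def by (rule ball) (use x u ue in \<open>auto intro: D_infty_plus_add\<close>)
    moreover have "coeff_scale c (x - u) \<in> A"
      unfolding c_def
    proof (rule ball)
      have "?n k (x - u - x) = ?n k u"
        using D_infty_plus_norm_minus_commute[OF u zero_in_D_infty_plus k] by simp
      then show "?n k (x - u - x) < e" using ue by simp
    qed (rule D_infty_plus_diff[OF x u])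
    ultimately have "coeff_scale (1/2) (coeff_scale c (x + u)) + coeff_scale (-1/2) (coeff_scale c (x - u)) \<in> A"
      using conv unfolding absolutely_convex_def by (simp add: norm_divide)
    moreover have "coeff_scale (1/2) (coeff_scale c (x + u)) + coeff_scale (-1/2) (coeff_scale c (x - u)) = coeff_scale c u"
      by (simp add: coeff_scale_def fun_eq_iff algebra_simps)
    moreover have "coeff_scale c u = v"
      by (simp add: u_def c_def coeff_scale_def mult.assoc[symmetric] del: of_nat_Suc)
    ultimately show ?thesis by simp
  qed
  moreover have "0 < e / real (Suc n)" using e by simp
  moreover have "A \<subseteq> ?V" using cl by (simp add: closedin_D_infty_plus_topology)
  ultimately show "zero_neighbourhood (D_infty_plus_topology lam) A"
    unfolding zero_neighbourhood_D_infty_plus using k by blast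
qed

section \<open>The equivalence\<close>

theorem theorem5p4:
  fixes lam :: "nat \<Rightarrow> real"
  assumes "frequency lam"
  shows "bohr_theorem_holds lam \<longleftrightarrow> montel_space coeff_scale (D_infty_plus_topology lam)"
  unfolding montel_space_def
  using barrelled_imp_bohr[OF assms] bohr_imp_barrelled[OF assms] bohr_imp_semi_montel[OF assms] by blast

end
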